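(* Let $\mathcal{E}$ be a locally Cartesian closed category and $(\mathbb{T},+,0)$ a monoid in $\mathcal{E}$. The assignment $p\mapsto \mathbf{Dyn}^{\mathbb{T}}(p)$, sending a polynomial $p$ to the category of open dynamical systems over $p$ with time $\mathbb{T}$, extends to a polynomially-indexed category $\mathbf{Dyn}^{\mathbb{T}}:\mathbf{Poly}_{\mathcal{E}}\to\mathbf{Cat}$. For a morphism of polynomials $\varphi:p\to q$, the functor $\mathbf{Dyn}^{\mathbb{T}}(\varphi):\mathbf{Dyn}^{\mathbb{T}}(p)\to\mathbf{Dyn}^{\mathbb{T}}(q)$ is defined on an object $(X,\vartheta^o,\vartheta^u)$ as the triple $(X,\ \varphi_1\circ\vartheta^o,\ \vartheta^u\circ{\vartheta^o}^{*}\varphi^{\#})$, where the two maps are explicitly the composites $$\mathbb{T}\times X\xrightarrow{\vartheta^o}p(1)\xrightarrow{\varphi_1}q(1),\qquad \sum_{t:\mathbb{T}}\sum_{x:X}q[\varphi_1\circ\vartheta^o(t,x)]\xrightarrow{{\vartheta^o}^{*}\varphi^{\#}}\sum_{t:\mathbb{T}}\sum_{x:X}p[\vartheta^o(t,x)]\xrightarrow{\vartheta^u}X .$$ On a morphism $f:(X,\vartheta^o,\vartheta^u)\to(Y,\psi^o,\psi^u)$, $\mathbf{Dyn}^{\mathbb{T}}(\varphi)(f)$ is given by the same underlying map $f:X\to Y$ of state spaces.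
   Context: Polynomials. A polynomial functor on $\mathcal{E}$ is a coproduct of representables $p=\sum_{i:p(1)}y^{p[i]}$, where $y^A=\mathcal{E}(A,-)$ and $p(1)$ is an object of $\mathcal{E}$; equivalently it is a bundle (morphism of $\mathcal{E}$) $p:\sum_{i:p(1)}p[i]\to p(1)$ with fibres $p[i]$. $\mathbf{Poly}_{\mathcal{E}}$ is the full subcategory of $[\mathcal{E},\mathcal{E}]$ on polynomial functors. A morphism $\varphi:p\to q$ is equivalently a pair of a map $\varphi_1:p(1)\to q(1)$ and a map $\varphi^{\#}:\sum_{i:p(1)}q[\varphi_1(i)]\to\sum_{i:p(1)}p[i]$ over $p(1)$; composites are given by composing forward maps and by $(\chi\varphi)^{\#}=\varphi^{\#}\circ\varphi_1^{*}\chi^{\#}$. A section of $p$ is a map $\sigma:p(1)\to\sum_{i:p(1)}p[i]$ with $p\circ\sigma=\mathrm{id}$. Open dynamical systems. An open dynamical system on the interface $p$ with state space $S:\mathcal{E}$ and time $\mathbb{T}$ is a tuple $\vartheta=(S,\vartheta^o,\vartheta^u)$ with $\vartheta^o:\mathbb{T}\times S\to p(1)$ and $\vartheta^u:\sum_{t:\mathbb{T}}\sum_{s:S}p[\vartheta^o(t,s)]\to S$, such that for every section $\sigma$ of $p$ the closure $\vartheta^\sigma:\mathbb{T}\times S\to S$, $\vartheta^\sigma(t)=\vartheta^u(t)\circ\vartheta^o(t)^{*}\sigma$ (where $\vartheta^o(t)^{*}\sigma:S\to\sum_{s:S}p[\vartheta^o(t,s)]$ is the pullback of $\sigma$ along $\vartheta^o(t)$),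 satisfies the flow conditions $\vartheta^\sigma(0)=\mathrm{id}_S$ and $\vartheta^\sigma(s+t)=\vartheta^\sigma(s)\circ\vartheta^\sigma(t)$. The category $\mathbf{Dyn}^{\mathbb{T}}(p)$ has these as objects; a morphism $(X,\vartheta^o,\vartheta^u)\to(Y,\psi^o,\psi^u)$ is a map $f:X\to Y$ in $\mathcal{E}$ such that for every $t:\mathbb{T}$ and every section $\sigma$ of $p$, $f\circ\vartheta^u(t)\circ\vartheta^o(t)^{*}\sigma=\psi^u(t)\circ\psi^o(t)^{*}\sigma\circ f$. Identities and composition are those of maps of state spaces. An "indexed category" here is a (pseudo)functor into $\mathbf{Cat}$. *)

theory Defs
  imports Main "HOL-Library.FuncSet"
begin

section \<open>Categories and functors\<close>

record ('o, 'a) cat =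
  Obj :: "'o set"
  Arr :: "'a set"
  Dom :: "'a \<Rightarrow> 'o"
  Cod :: "'a \<Rightarrow> 'o"
  Ident :: "'o \<Rightarrow> 'a"
  Comp :: "'a \<Rightarrow> 'a \<Rightarrow> 'a"  (infixr "\<cdot>\<index>" 55)

definition hom :: "('o, 'a) cat \<Rightarrow> 'o \<Rightarrow> 'o \<Rightarrow> 'a set" where
  "hom C A B = {f \<in> Arr C. Dom C f = A \<and> Cod C f = B}"

definition category :: "('o, 'a) cat \<Rightarrow> bool" where
  "category C \<longleftrightarrow>
     (\<forall>f \<in> Arr C. Dom C f \<in> Obj C \<and> Cod C f \<in> Obj C) \<and>
     (\<forall>A \<in> Obj C. Ident C A \<in> hom C A A) \<and>
     (\<forall>A B D f g. f \<in> hom C A B \<longrightarrow> g \<in> hom C B D \<longrightarrow> g \<cdot>\<^bsub>C\<^esub> f \<in> hom C A D) \<and>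
     (\<forall>A B f. f \<in> hom C A B \<longrightarrow> f \<cdot>\<^bsub>C\<^esub> Ident C A = f \<and> Ident C B \<cdot>\<^bsub>C\<^esub> f = f) \<and>
     (\<forall>A B D F f g h. f \<in> hom C A B \<longrightarrow> g \<in> hom C B D \<longrightarrow> h \<in> hom C D F \<longrightarrow>
        (h \<cdot>\<^bsub>C\<^esub> g) \<cdot>\<^bsub>C\<^esub> f = h \<cdot>\<^bsub>C\<^esub> (g \<cdot>\<^bsub>C\<^esub> f))"

record ('o, 'a, 'p, 'b) functor_data =
  Src :: "('o, 'a) cat"
  Tgt :: "('p, 'b) cat"
  OMap :: "'o \<Rightarrow> 'p"
  AMap :: "'a \<Rightarrow> 'b"

text \<open>The two maps of a functor are required to be extensional (\<open>undefined\<close> outside the source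
  category), so that equality of functors is HOL equality.\<close>

definition is_functor :: "('o, 'a, 'p, 'b) functor_data \<Rightarrow> bool" where
  "is_functor F \<longleftrightarrow>
     category (Src F) \<and> category (Tgt F) \<and>
     OMap F \<in> Obj (Src F) \<rightarrow>\<^sub>E Obj (Tgt F) \<and>
     AMap F \<in> Arr (Src F) \<rightarrow>\<^sub>E Arr (Tgt F) \<and>
     (\<forall>A B f. f \<in> hom (Src F) A B \<longrightarrow> AMap F f \<in> hom (Tgt F) (OMap F A) (OMap F B)) \<and>
     (\<forall>A \<in> Obj (Src F). AMap F (Ident (Src F) A) = Ident (Tgt F) (OMap F A)) \<and>
     (\<forall>A B D f g. f \<in> hom (Src F) A B \<longrightarrow> g \<in> hom (Src F) B D \<longrightarrow>
        AMap F (g \<cdot>\<^bsub>Src F\<^esub> f) = AMap F g \<cdot>\<^bsub>Tgt F\<^esub> AMap F f)"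

definition id_functor :: "('o, 'a) cat \<Rightarrow> ('o, 'a, 'o, 'a) functor_data" where
  "id_functor C = \<lparr>Src = C, Tgt = C, OMap = (\<lambda>A \<in> Obj C. A), AMap = (\<lambda>f \<in> Arr C. f)\<rparr>"

definition comp_functor ::
  "('p, 'b, 'q, 'c) functor_data \<Rightarrow> ('o, 'a, 'p, 'b) functor_data
     \<Rightarrow> ('o, 'a, 'q, 'c) functor_data" where
  "comp_functor G F =
     \<lparr>Src = Src F, Tgt = Tgt G,
      OMap = compose (Obj (Src F)) (OMap G) (OMap F),
      AMap = compose (Arr (Src F)) (AMap G) (AMap F)\<rparr>"

text \<open>The category of categories whose objects and arrows are drawn from two fixed types;
  they play the role of a size bound.\<close>

definition CAT :: "(('o, 'a) cat, ('o, 'a, 'o, 'a) functor_data) cat" where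
  "CAT = \<lparr>Obj = {C. category C}, Arr = {F. is_functor F}, Dom = Src, Cod = Tgt,
          Ident = id_functor, Comp = comp_functor\<rparr>"


section \<open>Cartesian closed and locally Cartesian closed categories\<close>

definition is_terminal :: "('o, 'a) cat \<Rightarrow> 'o \<Rightarrow> bool" where
  "is_terminal C U \<longleftrightarrow> U \<in> Obj C \<and> (\<forall>A \<in> Obj C. \<exists>!f. f \<in> hom C A U)"

definition is_product :: "('o, 'a) cat \<Rightarrow> 'o \<Rightarrow> 'o \<Rightarrow> 'o \<Rightarrow> 'a \<Rightarrow> 'a \<Rightarrow> bool" where
  "is_product C A B P p1 p2 \<longleftrightarrow>
     p1 \<in> hom C P A \<and> p2 \<in> hom C P B \<and>
     (\<forall>X f g. f \<in> hom C X A \<longrightarrow> g \<in> hom C X B \<longrightarrow>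
        (\<exists>!h. h \<in> hom C X P \<and> p1 \<cdot>\<^bsub>C\<^esub> h = f \<and> p2 \<cdot>\<^bsub>C\<^esub> h = g))"

text \<open>\<open>Z\<close> is the exponential \<open>B\<^sup>A\<close>, with evaluation \<open>ev\<close> on the product \<open>P\<close> of \<open>Z\<close> and \<open>A\<close>; the arrow
  \<open>k\<close> below is \<open>h \<times> A\<close>.\<close>

definition is_exponential ::
  "('o, 'a) cat \<Rightarrow> 'o \<Rightarrow> 'o \<Rightarrow> 'o \<Rightarrow> 'o \<Rightarrow> 'a \<Rightarrow> 'a \<Rightarrow> 'a \<Rightarrow> bool" where
  "is_exponential C A B Z P p1 p2 ev \<longleftrightarrow>
     is_product C Z A P p1 p2 \<and> ev \<in> hom C P B \<and>
     (\<forall>W Q q1 q2 g. is_product C W A Q q1 q2 \<longrightarrow> g \<in> hom C Q B \<longrightarrow>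
        (\<exists>!h. h \<in> hom C W Z \<and>
           (\<exists>k \<in> hom C Q P. p1 \<cdot>\<^bsub>C\<^esub> k = h \<cdot>\<^bsub>C\<^esub> q1 \<and> p2 \<cdot>\<^bsub>C\<^esub> k = q2 \<and> ev \<cdot>\<^bsub>C\<^esub> k = g)))"

definition has_terminal :: "('o, 'a) cat \<Rightarrow> bool" where
  "has_terminal C \<longleftrightarrow> (\<exists>U. is_terminal C U)"

definition cartesian_closed :: "('o, 'a) cat \<Rightarrow> bool" where
  "cartesian_closed C \<longleftrightarrow>
     category C \<and> has_terminal C \<and>
     (\<forall>A \<in> Obj C. \<forall>B \<in> Obj C. \<exists>P p1 p2. is_product C A B P p1 p2) \<and>
     (\<forall>A \<in> Obj C. \<forall>B \<in> Obj C. \<exists>Z P p1 p2 ev. is_exponential C A B Z P p1 p2 ev)"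

text \<open>An arrow \<open>(f, h, g)\<close> of the slice over \<open>B\<close> is an arrow \<open>h\<close> from \<open>f\<close> to \<open>g\<close>.\<close>

definition slice :: "('o, 'a) cat \<Rightarrow> 'o \<Rightarrow> ('a, 'a \<times> 'a \<times> 'a) cat" where
  "slice C B =
     \<lparr>Obj = {f \<in> Arr C. Cod C f = B},
      Arr = {(f, h, g). f \<in> Arr C \<and> Cod C f = B \<and> g \<in> Arr C \<and> Cod C g = B \<and>
                        h \<in> hom C (Dom C f) (Dom C g) \<and> g \<cdot>\<^bsub>C\<^esub> h = f},
      Dom = (\<lambda>(f, h, g). f), Cod = (\<lambda>(f, h, g). g),
      Ident = (\<lambda>f. (f, Ident C (Dom C f), f)),
      Comp = (\<lambda>(f', h', g') (f, h, g). (f, h' \<cdot>\<^bsub>C\<^esub> h, g'))\<rparr>"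

definition locally_cartesian_closed :: "('o, 'a) cat \<Rightarrow> bool" where
  "locally_cartesian_closed C \<longleftrightarrow> category C \<and> (\<forall>B \<in> Obj C. cartesian_closed (slice C B))"


section \<open>Chosen finite limits\<close>

text \<open>A category with finite limits is equipped with a choice of terminal object, binary products
  and pullbacks by Hilbert choice. In particular the object \<open>f\<^sup>* x\<close>, which is the internal sum of
  the fibres \<open>x[f(a)]\<close>, is a definite object.\<close>

definition terminal :: "('o, 'a) cat \<Rightarrow> 'o" where
  "terminal C = (SOME U. is_terminal C U)"

definition to_terminal :: "('o, 'a) cat \<Rightarrow> 'o \<Rightarrow> 'a" where
  "to_terminal C A = (THE f. f \<in> hom C A (terminal C))"

definition product :: "('o, 'a) cat \<Rightarrow> 'o \<Rightarrow> 'o \<Rightarrow> 'o \<times> 'a \<times> 'a" where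
  "product C A B = (SOME (P, p1, p2). is_product C A B P p1 p2)"

definition prod_obj :: "('o, 'a) cat \<Rightarrow> 'o \<Rightarrow> 'o \<Rightarrow> 'o" where
  "prod_obj C A B = fst (product C A B)"

definition prod_fst :: "('o, 'a) cat \<Rightarrow> 'o \<Rightarrow> 'o \<Rightarrow> 'a" where
  "prod_fst C A B = fst (snd (product C A B))"

definition prod_snd :: "('o, 'a) cat \<Rightarrow> 'o \<Rightarrow> 'o \<Rightarrow> 'a" where
  "prod_snd C A B = snd (snd (product C A B))"

definition prod_pair :: "('o, 'a) cat \<Rightarrow> 'a \<Rightarrow> 'a \<Rightarrow> 'a" where
  "prod_pair C f g =
     (THE h. h \<in> hom C (Dom C f) (prod_obj C (Cod C f) (Cod C g)) \<and>
             prod_fst C (Cod C f) (Cod C g) \<cdot>\<^bsub>C\<^esub> h = f \<and>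
             prod_snd C (Cod C f) (Cod C g) \<cdot>\<^bsub>C\<^esub> h = g)"

definition prod_arr :: "('o, 'a) cat \<Rightarrow> 'a \<Rightarrow> 'a \<Rightarrow> 'a" where
  "prod_arr C f g =
     prod_pair C (f \<cdot>\<^bsub>C\<^esub> prod_fst C (Dom C f) (Dom C g)) (g \<cdot>\<^bsub>C\<^esub> prod_snd C (Dom C f) (Dom C g))"

text \<open>The associator from \<open>(A \<times> B) \<times> D\<close> to \<open>A \<times> (B \<times> D)\<close>.\<close>

definition prod_assoc :: "('o, 'a) cat \<Rightarrow> 'o \<Rightarrow> 'o \<Rightarrow> 'o \<Rightarrow> 'a" where
  "prod_assoc C A B D =
     (let l = prod_fst C (prod_obj C A B) D; r = prod_snd C (prod_obj C A B) D
      in prod_pair C (prod_fst C A B \<cdot>\<^bsub>C\<^esub> l) (prod_pair C (prod_snd C A B \<cdot>\<^bsub>C\<^esub> l) r))"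

definition is_pullback :: "('o, 'a) cat \<Rightarrow> 'a \<Rightarrow> 'a \<Rightarrow> 'o \<Rightarrow> 'a \<Rightarrow> 'a \<Rightarrow> bool" where
  "is_pullback C f x P p1 p2 \<longleftrightarrow>
     f \<in> Arr C \<and> x \<in> Arr C \<and> Cod C f = Cod C x \<and>
     p1 \<in> hom C P (Dom C f) \<and> p2 \<in> hom C P (Dom C x) \<and> f \<cdot>\<^bsub>C\<^esub> p1 = x \<cdot>\<^bsub>C\<^esub> p2 \<and>
     (\<forall>X a b. a \<in> hom C X (Dom C f) \<longrightarrow> b \<in> hom C X (Dom C x) \<longrightarrow> f \<cdot>\<^bsub>C\<^esub> a = x \<cdot>\<^bsub>C\<^esub> b \<longrightarrow>
        (\<exists>!h. h \<in> hom C X P \<and> p1 \<cdot>\<^bsub>C\<^esub> h = a \<and> p2 \<cdot>\<^bsub>C\<^esub> h = b))"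

definition pullback :: "('o, 'a) cat \<Rightarrow> 'a \<Rightarrow> 'a \<Rightarrow> 'o \<times> 'a \<times> 'a" where
  "pullback C f x = (SOME (P, p1, p2). is_pullback C f x P p1 p2)"

text \<open>For \<open>f : A \<rightarrow> B\<close> and \<open>x\<close> over \<open>B\<close>, the bundle \<open>f\<^sup>* x\<close> over \<open>A\<close> is \<open>pb_proj C f x\<close>, with total
  space \<open>pb_obj C f x\<close>; \<open>pb_top C f x\<close> is the projection to the total space of \<open>x\<close>.\<close>

definition pb_obj :: "('o, 'a) cat \<Rightarrow> 'a \<Rightarrow> 'a \<Rightarrow> 'o" where
  "pb_obj C f x = fst (pullback C f x)"

definition pb_proj :: "('o, 'a) cat \<Rightarrow> 'a \<Rightarrow> 'a \<Rightarrow> 'a" where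
  "pb_proj C f x = fst (snd (pullback C f x))"

definition pb_top :: "('o, 'a) cat \<Rightarrow> 'a \<Rightarrow> 'a \<Rightarrow> 'a" where
  "pb_top C f x = snd (snd (pullback C f x))"

definition pb_pair :: "('o, 'a) cat \<Rightarrow> 'a \<Rightarrow> 'a \<Rightarrow> 'a \<Rightarrow> 'a \<Rightarrow> 'a" where
  "pb_pair C f x a b =
     (THE h. h \<in> hom C (Dom C a) (pb_obj C f x) \<and>
             pb_proj C f x \<cdot>\<^bsub>C\<^esub> h = a \<and> pb_top C f x \<cdot>\<^bsub>C\<^esub> h = b)"

text \<open>The arrow \<open>f\<^sup>* h : f\<^sup>* x \<rightarrow> f\<^sup>* y\<close> for \<open>h : x \<rightarrow> y\<close> over the codomain of \<open>f\<close>.\<close>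

definition pb_arr :: "('o, 'a) cat \<Rightarrow> 'a \<Rightarrow> 'a \<Rightarrow> 'a \<Rightarrow> 'a \<Rightarrow> 'a" where
  "pb_arr C f x y h = pb_pair C f y (pb_proj C f x) (h \<cdot>\<^bsub>C\<^esub> pb_top C f x)"

text \<open>The canonical isomorphism \<open>(g \<circ> f)\<^sup>* x \<rightarrow> f\<^sup>* (g\<^sup>* x)\<close>.\<close>

definition pb_paste :: "('o, 'a) cat \<Rightarrow> 'a \<Rightarrow> 'a \<Rightarrow> 'a \<Rightarrow> 'a" where
  "pb_paste C f g x =
     pb_pair C f (pb_proj C g x) (pb_proj C (g \<cdot>\<^bsub>C\<^esub> f) x)
       (pb_pair C g x (f \<cdot>\<^bsub>C\<^esub> pb_proj C (g \<cdot>\<^bsub>C\<^esub> f) x) (pb_top C (g \<cdot>\<^bsub>C\<^esub> f) x))"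

text \<open>For \<open>h : g\<^sup>* x \<rightarrow> y\<close>, the arrow \<open>f\<^sup>* h\<close> regarded as an arrow \<open>(g \<circ> f)\<^sup>* x \<rightarrow> f\<^sup>* y\<close>; in terms of
  fibres, from the sum of the \<open>x[g(f(a))]\<close> to the sum of the \<open>y[f(a)]\<close>.\<close>

definition reindex :: "('o, 'a) cat \<Rightarrow> 'a \<Rightarrow> 'a \<Rightarrow> 'a \<Rightarrow> 'a \<Rightarrow> 'a \<Rightarrow> 'a" where
  "reindex C f g x y h = pb_arr C f (pb_proj C g x) y h \<cdot>\<^bsub>C\<^esub> pb_paste C f g x"

definition monoid_object :: "('o, 'a) cat \<Rightarrow> 'o \<Rightarrow> 'a \<Rightarrow> 'a \<Rightarrow> bool" where
  "monoid_object C T \<mu> \<eta> \<longleftrightarrow>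
     T \<in> Obj C \<and> \<mu> \<in> hom C (prod_obj C T T) T \<and> \<eta> \<in> hom C (terminal C) T \<and>
     \<mu> \<cdot>\<^bsub>C\<^esub> prod_arr C \<mu> (Ident C T) =
       \<mu> \<cdot>\<^bsub>C\<^esub> prod_arr C (Ident C T) \<mu> \<cdot>\<^bsub>C\<^esub> prod_assoc C T T T \<and>
     \<mu> \<cdot>\<^bsub>C\<^esub> prod_pair C (\<eta> \<cdot>\<^bsub>C\<^esub> to_terminal C T) (Ident C T) = Ident C T \<and>
     \<mu> \<cdot>\<^bsub>C\<^esub> prod_pair C (Ident C T) (\<eta> \<cdot>\<^bsub>C\<^esub> to_terminal C T) = Ident C T"


section \<open>Polynomials\<close>

text \<open>A polynomial is a bundle, i.e. an arrow \<open>p\<close> of \<open>E\<close>: its codomain is \<open>p(1)\<close>, and its domain is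
  the sum of the fibres \<open>p[i]\<close>.\<close>

record 'a poly_map =
  PSrc :: 'a
  PTgt :: 'a
  Fwd :: 'a
  Bwd :: 'a

definition is_poly_map :: "('o, 'a) cat \<Rightarrow> 'a poly_map \<Rightarrow> bool" where
  "is_poly_map E \<phi> \<longleftrightarrow>
     PSrc \<phi> \<in> Arr E \<and> PTgt \<phi> \<in> Arr E \<and>
     Fwd \<phi> \<in> hom E (Cod E (PSrc \<phi>)) (Cod E (PTgt \<phi>)) \<and>
     Bwd \<phi> \<in> hom E (pb_obj E (Fwd \<phi>) (PTgt \<phi>)) (Dom E (PSrc \<phi>)) \<and>
     PSrc \<phi> \<cdot>\<^bsub>E\<^esub> Bwd \<phi> = pb_proj E (Fwd \<phi>) (PTgt \<phi>)"

definition poly_id :: "('o, 'a) cat \<Rightarrow> 'a \<Rightarrow> 'a poly_map" where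
  "poly_id E p =
     \<lparr>PSrc = p, PTgt = p, Fwd = Ident E (Cod E p), Bwd = pb_top E (Ident E (Cod E p)) p\<rparr>"

definition poly_comp :: "('o, 'a) cat \<Rightarrow> 'a poly_map \<Rightarrow> 'a poly_map \<Rightarrow> 'a poly_map" where
  "poly_comp E \<chi> \<phi> =
     \<lparr>PSrc = PSrc \<phi>, PTgt = PTgt \<chi>, Fwd = Fwd \<chi> \<cdot>\<^bsub>E\<^esub> Fwd \<phi>,
      Bwd = Bwd \<phi> \<cdot>\<^bsub>E\<^esub> reindex E (Fwd \<phi>) (Fwd \<chi>) (PTgt \<chi>) (PSrc \<chi>) (Bwd \<chi>)\<rparr>"

definition Poly :: "('o, 'a) cat \<Rightarrow> ('a, 'a poly_map) cat" where
  "Poly E = \<lparr>Obj = Arr E, Arr = {\<phi>. is_poly_map E \<phi>}, Dom = PSrc, Cod = PTgt,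
             Ident = poly_id E, Comp = poly_comp E\<rparr>"

definition poly_section :: "('o, 'a) cat \<Rightarrow> 'a \<Rightarrow> 'a \<Rightarrow> bool" where
  "poly_section E p \<sigma> \<longleftrightarrow> \<sigma> \<in> hom E (Cod E p) (Dom E p) \<and> p \<cdot>\<^bsub>E\<^esub> \<sigma> = Ident E (Cod E p)"

text \<open>The pullback \<open>f\<^sup>* \<sigma>\<close> of a section \<open>\<sigma>\<close> of \<open>p\<close>, as a section of \<open>f\<^sup>* p\<close>.\<close>

definition pb_section :: "('o, 'a) cat \<Rightarrow> 'a \<Rightarrow> 'a \<Rightarrow> 'a \<Rightarrow> 'a" where
  "pb_section E f p \<sigma> = pb_pair E f p (Ident E (Dom E f)) (\<sigma> \<cdot>\<^bsub>E\<^esub> f)"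


section \<open>Open dynamical systems\<close>

text \<open>A system with interface \<open>p\<close> is a triple \<open>(S, out, upd)\<close> of a state space, an output map and an
  update map; the latter is defined on the total space of \<open>out\<^sup>* p\<close>, the sum of the fibres
  \<open>p[out(t, s)]\<close> over all \<open>t\<close> and \<open>s\<close>.\<close>

type_synonym ('o, 'a) dyn_sys = "'o \<times> 'a \<times> 'a"

definition sys_closure :: "('o, 'a) cat \<Rightarrow> 'a \<Rightarrow> ('o, 'a) dyn_sys \<Rightarrow> 'a \<Rightarrow> 'a" where
  "sys_closure E p = (\<lambda>(S, out, upd) \<sigma>. upd \<cdot>\<^bsub>E\<^esub> pb_section E out p \<sigma>)"

text \<open>For an arrow \<open>\<theta> : T \<times> S \<rightarrow> S\<close>: \<open>\<theta>(0) = id\<close> and \<open>\<theta>(s + t) = \<theta>(s) \<circ> \<theta>(t)\<close>, the variables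
  \<open>s, t : T\<close> being those of the internal language of \<open>E\<close>.\<close>

definition is_flow :: "('o, 'a) cat \<Rightarrow> 'o \<Rightarrow> 'a \<Rightarrow> 'a \<Rightarrow> 'o \<Rightarrow> 'a \<Rightarrow> bool" where
  "is_flow E T \<mu> \<eta> S \<theta> \<longleftrightarrow>
     \<theta> \<cdot>\<^bsub>E\<^esub> prod_pair E (\<eta> \<cdot>\<^bsub>E\<^esub> to_terminal E S) (Ident E S) = Ident E S \<and>
     \<theta> \<cdot>\<^bsub>E\<^esub> prod_arr E \<mu> (Ident E S) =
       \<theta> \<cdot>\<^bsub>E\<^esub> prod_arr E (Ident E T) \<theta> \<cdot>\<^bsub>E\<^esub> prod_assoc E T T S"

definition is_dyn_sys ::
  "('o, 'a) cat \<Rightarrow> 'o \<Rightarrow> 'a \<Rightarrow> 'a \<Rightarrow> 'a \<Rightarrow> ('o, 'a) dyn_sys \<Rightarrow> bool" where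
  "is_dyn_sys E T \<mu> \<eta> p = (\<lambda>(S, out, upd).
     S \<in> Obj E \<and> out \<in> hom E (prod_obj E T S) (Cod E p) \<and> upd \<in> hom E (pb_obj E out p) S \<and>
     (\<forall>\<sigma>. poly_section E p \<sigma> \<longrightarrow> is_flow E T \<mu> \<eta> S (sys_closure E p (S, out, upd) \<sigma>)))"

definition is_dyn_map ::
  "('o, 'a) cat \<Rightarrow> 'o \<Rightarrow> 'a \<Rightarrow> ('o, 'a) dyn_sys \<Rightarrow> 'a \<Rightarrow> ('o, 'a) dyn_sys \<Rightarrow> bool" where
  "is_dyn_map E T p \<theta> f \<psi> \<longleftrightarrow>
     f \<in> hom E (fst \<theta>) (fst \<psi>) \<and>
     (\<forall>\<sigma>. poly_section E p \<sigma> \<longrightarrow>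
        f \<cdot>\<^bsub>E\<^esub> sys_closure E p \<theta> \<sigma> = sys_closure E p \<psi> \<sigma> \<cdot>\<^bsub>E\<^esub> prod_arr E (Ident E T) f)"

text \<open>An arrow \<open>(\<theta>, f, \<psi>)\<close> is the map of state spaces \<open>f\<close> together with its source and target.\<close>

definition Dyn ::
  "('o, 'a) cat \<Rightarrow> 'o \<Rightarrow> 'a \<Rightarrow> 'a \<Rightarrow> 'a
     \<Rightarrow> (('o, 'a) dyn_sys, ('o, 'a) dyn_sys \<times> 'a \<times> ('o, 'a) dyn_sys) cat" where
  "Dyn E T \<mu> \<eta> p =
     \<lparr>Obj = {\<theta>. is_dyn_sys E T \<mu> \<eta> p \<theta>},
      Arr = {(\<theta>, f, \<psi>). is_dyn_sys E T \<mu> \<eta> p \<theta> \<and> is_dyn_sys E T \<mu> \<eta> p \<psi> \<and>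
                        is_dyn_map E T p \<theta> f \<psi>},
      Dom = (\<lambda>(\<theta>, f, \<psi>). \<theta>), Cod = (\<lambda>(\<theta>, f, \<psi>). \<psi>),
      Ident = (\<lambda>\<theta>. (\<theta>, Ident E (fst \<theta>), \<theta>)),
      Comp = (\<lambda>(\<theta>', g, \<psi>') (\<theta>, f, \<psi>). (\<theta>, g \<cdot>\<^bsub>E\<^esub> f, \<psi>'))\<rparr>"

end

theory Submission
  imports Defs
begin

text \<open>
  A system \<open>(S, out, upd)\<close> with interface \<open>p\<close> consists of a map \<open>out : T \<times> S \<rightarrow> p(1)\<close> and a map
  \<open>upd\<close> out of the total space of \<open>out\<^sup>* p\<close>. Except that \<open>upd\<close> ends in \<open>S\<close> and not in a bundle over
  \<open>T \<times> S\<close>, these are the forward and backward parts of a map of polynomials into \<open>p\<close>, and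
  changing the interface along \<open>\<phi> : p \<rightarrow> q\<close> is given by the formula for composing maps of polynomials. Hence one computation
  carries both the associativity of composition of polynomial maps and the functoriality of
  changing the interface: reindexing along \<open>\<chi> \<circ> \<phi>\<close> is reindexing along \<open>\<chi>\<close> followed by reindexing
  along \<open>\<phi>\<close> (\<open>reindex_along_poly_comp\<close>), and reindexing along an identity is an identity
  (\<open>reindex_along_id\<close>).

  These laws are equalities and not only isomorphisms, although the chosen pullbacks
  \<open>(g \<circ> f)\<^sup>* x\<close> and \<open>f\<^sup>* (g\<^sup>* x)\<close> differ. The reason is that \<open>reindex\<close> starts at the pullback along
  the composite, having the comparison isomorphism built in, so that both sides of each law are maps
  between the same two chosen pullbacks and can be compared by their two projections. The indexed
  category is therefore a strict functor.

  That changing the interface preserves the flow conditions and the maps of systems has one cause: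
  a section \<open>\<sigma>\<close> of \<open>q\<close> pulls back along \<open>\<phi>\<close> to the section \<open>\<phi>\<^sup># \<circ> \<phi>\<^sub>1\<^sup>* \<sigma>\<close> of \<open>p\<close>, and closing the
  changed system by \<open>\<sigma>\<close> gives the same map \<open>T \<times> S \<rightarrow> S\<close> as closing the original system by the
  pulled back section (\<open>sys_closure_change_interface\<close>). Both notions are conditions on the closures
  by all sections, so each instance over \<open>q\<close> is an instance over \<open>p\<close>.

  The finite limits come from the slices: products in the slice over \<open>B\<close> are pullbacks over \<open>B\<close>,
  and pullbacks over the terminal object are products.
\<close>

section \<open>The category of categories\<close>

lemma categoryI:
  assumes "\<And>f. f \<in> Arr C \<Longrightarrow> Dom C f \<in> Obj C" "\<And>f. f \<in> Arr C \<Longrightarrow> Cod C f \<in> Obj C"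
    and "\<And>A. A \<in> Obj C \<Longrightarrow> Ident C A \<in> hom C A A"
    and "\<And>A B D f g. f \<in> hom C A B \<Longrightarrow> g \<in> hom C B D \<Longrightarrow> g \<cdot>\<^bsub>C\<^esub> f \<in> hom C A D"
    and "\<And>A B f. f \<in> hom C A B \<Longrightarrow> f \<cdot>\<^bsub>C\<^esub> Ident C A = f"
    and "\<And>A B f. f \<in> hom C A B \<Longrightarrow> Ident C B \<cdot>\<^bsub>C\<^esub> f = f"
    and "\<And>A B D F f g h. f \<in> hom C A B \<Longrightarrow> g \<in> hom C B D \<Longrightarrow> h \<in> hom C D F \<Longrightarrow>
      (h \<cdot>\<^bsub>C\<^esub> g) \<cdot>\<^bsub>C\<^esub> f = h \<cdot>\<^bsub>C\<^esub> (g \<cdot>\<^bsub>C\<^esub> f)"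
  shows "category C"
  unfolding category_def
  by (intro conjI allI ballI impI) (fact assms | rule assms; assumption)+

lemma is_functorI:
  assumes "category (Src F)" "category (Tgt F)"
    and "OMap F \<in> extensional (Obj (Src F))" "AMap F \<in> extensional (Arr (Src F))"
    and obj: "\<And>A. A \<in> Obj (Src F) \<Longrightarrow> OMap F A \<in> Obj (Tgt F)"
    and arr: "\<And>A B f. f \<in> hom (Src F) A B \<Longrightarrow> AMap F f \<in> hom (Tgt F) (OMap F A) (OMap F B)"
    and "\<And>A. A \<in> Obj (Src F) \<Longrightarrow> AMap F (Ident (Src F) A) = Ident (Tgt F) (OMap F A)"
    and "\<And>A B D f g. f \<in> hom (Src F) A B \<Longrightarrow> g \<in> hom (Src F) B D \<Longrightarrow>
      AMap F (g \<cdot>\<^bsub>Src F\<^esub> f) = AMap F g \<cdot>\<^bsub>Tgt F\<^esub> AMap F f"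
  shows "is_functor F"
proof -
  have "AMap F f \<in> Arr (Tgt F)" if "f \<in> Arr (Src F)" for f
    using arr[of f "Dom (Src F) f" "Cod (Src F) f"] that by (simp add: hom_def)
  then have "AMap F \<in> Arr (Src F) \<rightarrow>\<^sub>E Arr (Tgt F)" "OMap F \<in> Obj (Src F) \<rightarrow>\<^sub>E Obj (Tgt F)"
    using assms(3,4) obj by (simp_all add: PiE_def Pi_def)
  then show ?thesis
    unfolding is_functor_def using assms(1,2)
    by (intro conjI allI ballI impI) (assumption | rule assms; assumption)+
qed

lemma functorD:
  assumes "is_functor F"
  shows "category (Src F)" "category (Tgt F)"
    and "OMap F \<in> extensional (Obj (Src F))" "AMap F \<in> extensional (Arr (Src F))"
    and "\<And>A. A \<in> Obj (Src F) \<Longrightarrow> OMap F A \<in> Obj (Tgt F)"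
    and "\<And>f. f \<in> Arr (Src F) \<Longrightarrow> AMap F f \<in> Arr (Tgt F)"
    and "\<And>A B f. f \<in> hom (Src F) A B \<Longrightarrow> AMap F f \<in> hom (Tgt F) (OMap F A) (OMap F B)"
    and "\<And>A. A \<in> Obj (Src F) \<Longrightarrow> AMap F (Ident (Src F) A) = Ident (Tgt F) (OMap F A)"
    and "\<And>A B D f g. f \<in> hom (Src F) A B \<Longrightarrow> g \<in> hom (Src F) B D \<Longrightarrow>
      AMap F (g \<cdot>\<^bsub>Src F\<^esub> f) = AMap F g \<cdot>\<^bsub>Tgt F\<^esub> AMap F f"
  using assms unfolding is_functor_def by (simp_all add: PiE_def Pi_def)

lemma categoryD:
  assumes "category C"
  shows "\<And>A. A \<in> Obj C \<Longrightarrow> Ident C A \<in> hom C A A"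
    and "\<And>A B D f g. f \<in> hom C A B \<Longrightarrow> g \<in> hom C B D \<Longrightarrow> g \<cdot>\<^bsub>C\<^esub> f \<in> hom C A D"
    and "\<And>f. f \<in> Arr C \<Longrightarrow> Dom C f \<in> Obj C" "\<And>f. f \<in> Arr C \<Longrightarrow> Cod C f \<in> Obj C"
    and "\<And>A B D F f g h. f \<in> hom C A B \<Longrightarrow> g \<in> hom C B D \<Longrightarrow> h \<in> hom C D F \<Longrightarrow>
      (h \<cdot>\<^bsub>C\<^esub> g) \<cdot>\<^bsub>C\<^esub> f = h \<cdot>\<^bsub>C\<^esub> (g \<cdot>\<^bsub>C\<^esub> f)"
    and "\<And>A B f. f \<in> hom C A B \<Longrightarrow> f \<cdot>\<^bsub>C\<^esub> Ident C A = f"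
    and "\<And>A B f. f \<in> hom C A B \<Longrightarrow> Ident C B \<cdot>\<^bsub>C\<^esub> f = f"
  using assms unfolding category_def by meson+

lemma is_functor_id: "category C \<Longrightarrow> is_functor (id_functor C)"
  using categoryD[of C]
  by (intro is_functorI) (auto simp: id_functor_def hom_def)

lemma is_functor_comp:
  assumes "is_functor F" "is_functor G" "Tgt F = Src G"
  shows "is_functor (comp_functor G F)"
proof (rule is_functorI)
  note F = functorD[OF assms(1)] and G = functorD[OF assms(2)]
    and C = categoryD[OF functorD(1)[OF assms(1)]]
  let ?H = "comp_functor G F"
  have on_obj: "OMap ?H A = OMap G (OMap F A)" if "A \<in> Obj (Src F)" for A
    using that by (simp add: comp_functor_def compose_def)
  have on_arr: "AMap ?H f = AMap G (AMap F f)" if "f \<in> Arr (Src F)" for f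
    using that by (simp add: comp_functor_def compose_def)
  have ends: "Src ?H = Src F" "Tgt ?H = Tgt G"
    by (simp_all add: comp_functor_def)
  have in_hom: "f \<in> Arr (Src F)" "A \<in> Obj (Src F)" "B \<in> Obj (Src F)"
    if "f \<in> hom (Src F) A B" for A B f
    using that C(3,4) by (auto simp: hom_def)
  show "category (Src ?H)" "category (Tgt ?H)" using F(1) G(2) by (simp_all add: ends)
  show "OMap ?H \<in> extensional (Obj (Src ?H))" "AMap ?H \<in> extensional (Arr (Src ?H))"
    by (simp_all add: comp_functor_def)
  show "OMap ?H A \<in> Obj (Tgt ?H)" if "A \<in> Obj (Src ?H)" for A
    using that F(5)[of A] G(5)[of "OMap F A"] assms(3) by (simp add: ends on_obj)
  show "AMap ?H f \<in> hom (Tgt ?H) (OMap ?H A) (OMap ?H B)" if "f \<in> hom (Src ?H) A B" for A B f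
    using that in_hom[of f A B] F(7)[of f A B] G(7)[of "AMap F f" "OMap F A" "OMap F B"] assms(3)
    by (simp add: ends on_obj on_arr)
  show "AMap ?H (Ident (Src ?H) A) = Ident (Tgt ?H) (OMap ?H A)" if "A \<in> Obj (Src ?H)" for A
    using that in_hom(1)[OF C(1)[of A]] F(5,8)[of A] G(8)[of "OMap F A"] assms(3)
    by (simp add: ends on_obj on_arr)
  show "AMap ?H (g \<cdot>\<^bsub>Src ?H\<^esub> f) = AMap ?H g \<cdot>\<^bsub>Tgt ?H\<^esub> AMap ?H f"
    if "f \<in> hom (Src ?H) A B" "g \<in> hom (Src ?H) B D" for A B D f g
    using that in_hom(1)[of f A B] in_hom(1)[of g B D] in_hom(1)[OF C(2)[of f A B g D]]
      F(7)[of f A B] F(7)[of g B D] F(9)[of f A B g D]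
      G(9)[of "AMap F f" "OMap F A" "OMap F B" "AMap F g" "OMap F D"] assms(3)
    by (simp add: ends on_arr)
qed

lemma comp_functor_id_right:
  assumes "is_functor F"
  shows "comp_functor F (id_functor (Src F)) = F"
  using functorD(3,4)[OF assms]
  by (intro functor_data.equality)
    (auto simp: comp_functor_def id_functor_def compose_def extensional_def fun_eq_iff)

lemma comp_functor_id_left:
  assumes "is_functor F"
  shows "comp_functor (id_functor (Tgt F)) F = F"
  using functorD(3-6)[OF assms]
  by (intro functor_data.equality)
    (auto simp: comp_functor_def id_functor_def compose_def extensional_def fun_eq_iff)

lemma comp_functor_assoc:
  assumes "is_functor F" "Tgt F = Src G"
  shows "comp_functor (comp_functor H G) F = comp_functor H (comp_functor G F)"
  using functorD(5,6)[OF assms(1)] assms(2)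
  by (intro functor_data.equality) (auto simp: comp_functor_def compose_def fun_eq_iff)

lemma category_CAT: "category CAT"
proof (rule categoryI)
  fix A B :: "('x, 'y) cat" and F
  assume "F \<in> hom CAT A B"
  then show "F \<cdot>\<^bsub>CAT\<^esub> Ident CAT A = F" "Ident CAT B \<cdot>\<^bsub>CAT\<^esub> F = F"
    using comp_functor_id_right[of F] comp_functor_id_left[of F] by (auto simp: CAT_def hom_def)
next
  fix A B C D :: "('x, 'y) cat" and F G H
  assume "F \<in> hom CAT A B" "G \<in> hom CAT B C" "H \<in> hom CAT C D"
  then show "(H \<cdot>\<^bsub>CAT\<^esub> G) \<cdot>\<^bsub>CAT\<^esub> F = H \<cdot>\<^bsub>CAT\<^esub> (G \<cdot>\<^bsub>CAT\<^esub> F)"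
    by (simp add: CAT_def hom_def comp_functor_assoc)
next
  fix A B C :: "('x, 'y) cat" and F G
  assume "F \<in> hom CAT A B" "G \<in> hom CAT B C"
  then show "G \<cdot>\<^bsub>CAT\<^esub> F \<in> hom CAT A C"
    using is_functor_comp[of F G] by (simp add: CAT_def hom_def comp_functor_def)
next
  fix A :: "('x, 'y) cat"
  assume "A \<in> Obj CAT"
  then show "Ident CAT A \<in> hom CAT A A"
    using is_functor_id[of A] by (simp add: CAT_def hom_def) (simp add: id_functor_def)
qed (auto simp: CAT_def functorD)

section \<open>Pullbacks\<close>

locale pullback_category =
  fixes E :: "('o, 'a) cat" (structure)
  assumes category: "category E"
    and pullbacks_exist: "f \<in> Arr E \<Longrightarrow> x \<in> Arr E \<Longrightarrow> Cod E f = Cod E x \<Longrightarrow>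
      \<exists>P p1 p2. is_pullback E f x P p1 p2"
begin

lemma dom_obj [simp]: "f \<in> Arr E \<Longrightarrow> Dom E f \<in> Obj E"
  and cod_obj [simp]: "f \<in> Arr E \<Longrightarrow> Cod E f \<in> Obj E"
  using categoryD(3,4)[OF category] by auto

lemma ident_arr [simp]:
  assumes "A \<in> Obj E"
  shows "Ident E A \<in> Arr E" "Dom E (Ident E A) = A" "Cod E (Ident E A) = A"
  using categoryD(1)[OF category assms] by (auto simp: hom_def)

lemma comp_arr [simp]:
  assumes "f \<in> Arr E" "g \<in> Arr E" "Cod E f = Dom E g"
  shows "g \<cdot> f \<in> Arr E" "Dom E (g \<cdot> f) = Dom E f" "Cod E (g \<cdot> f) = Cod E g"
  using categoryD(2)[OF category, of f "Dom E f" "Cod E f" g "Cod E g"] assms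
  by (auto simp: hom_def)

lemma comp_ident [simp]:
  assumes "f \<in> Arr E"
  shows "A = Dom E f \<Longrightarrow> f \<cdot> Ident E A = f" "B = Cod E f \<Longrightarrow> Ident E B \<cdot> f = f"
  using categoryD(6,7)[OF category, of f "Dom E f" "Cod E f"] assms by (auto simp: hom_def)

lemma comp_assoc [simp]:
  assumes "f \<in> Arr E" "g \<in> Arr E" "h \<in> Arr E" "Cod E f = Dom E g" "Cod E g = Dom E h"
  shows "(h \<cdot> g) \<cdot> f = h \<cdot> (g \<cdot> f)"
  using categoryD(5)[OF category, of f "Dom E f" "Cod E f" g "Cod E g" h "Cod E h"] assms
  by (simp add: hom_def)

lemma pullback_is_pullback:
  assumes "f \<in> Arr E" "x \<in> Arr E" "Cod E f = Cod E x"
  shows "is_pullback E f x (pb_obj E f x) (pb_proj E f x) (pb_top E f x)"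
proof -
  have "case pullback E f x of (P, p1, p2) \<Rightarrow> is_pullback E f x P p1 p2"
    unfolding pullback_def
    by (rule someI_ex) (use pullbacks_exist[OF assms] in auto)
  then show ?thesis by (simp add: pb_obj_def pb_proj_def pb_top_def split_beta)
qed

lemma pb_arrows [simp]:
  assumes "f \<in> Arr E" "x \<in> Arr E" "Cod E f = Cod E x"
  shows "pb_proj E f x \<in> Arr E" "Dom E (pb_proj E f x) = pb_obj E f x"
    "Cod E (pb_proj E f x) = Dom E f"
    "pb_top E f x \<in> Arr E" "Dom E (pb_top E f x) = pb_obj E f x"
    "Cod E (pb_top E f x) = Dom E x"
    "pb_obj E f x \<in> Obj E"
proof -
  show *: "pb_proj E f x \<in> Arr E" "Dom E (pb_proj E f x) = pb_obj E f x"
    "Cod E (pb_proj E f x) = Dom E f"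
    "pb_top E f x \<in> Arr E" "Dom E (pb_top E f x) = pb_obj E f x"
    "Cod E (pb_top E f x) = Dom E x"
    using pullback_is_pullback[OF assms] by (auto simp: is_pullback_def hom_def)
  show "pb_obj E f x \<in> Obj E" using * dom_obj by metis
qed

lemma pb_square [simp]:
  assumes "f \<in> Arr E" "x \<in> Arr E" "Cod E f = Cod E x"
  shows "x \<cdot> pb_top E f x = f \<cdot> pb_proj E f x"
  using pullback_is_pullback[OF assms] by (auto simp: is_pullback_def)

text \<open>Composites are kept associated to the right, so each equation between composites that is
  used for rewriting needs a second form in which both sides are precomposed with a further
  arrow.\<close>

lemma pb_square_comp [simp]:
  assumes "f \<in> Arr E" "x \<in> Arr E" "Cod E f = Cod E x" "k \<in> Arr E" "Cod E k = pb_obj E f x"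
  shows "x \<cdot> (pb_top E f x \<cdot> k) = f \<cdot> (pb_proj E f x \<cdot> k)"
  using assms pb_square[of f x] comp_assoc[of k "pb_top E f x" x]
    comp_assoc[of k "pb_proj E f x" f] by simp

lemma pb_universal:
  assumes "f \<in> Arr E" "x \<in> Arr E" "Cod E f = Cod E x"
    "a \<in> Arr E" "b \<in> Arr E" "Dom E a = Dom E b" "Cod E a = Dom E f" "Cod E b = Dom E x"
    "f \<cdot> a = x \<cdot> b"
  shows "\<exists>!h. h \<in> hom E (Dom E a) (pb_obj E f x) \<and> pb_proj E f x \<cdot> h = a \<and> pb_top E f x \<cdot> h = b"
proof -
  have "a \<in> hom E (Dom E a) (Dom E f)" "b \<in> hom E (Dom E a) (Dom E x)"
    using assms by (auto simp: hom_def)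
  then show ?thesis
    using pullback_is_pullback[OF assms(1-3)] assms(9) unfolding is_pullback_def by blast
qed

lemma pb_pair [simp]:
  assumes "f \<in> Arr E" "x \<in> Arr E" "Cod E f = Cod E x"
    "a \<in> Arr E" "b \<in> Arr E" "Dom E a = Dom E b" "Cod E a = Dom E f" "Cod E b = Dom E x"
    "f \<cdot> a = x \<cdot> b"
  shows "pb_pair E f x a b \<in> Arr E" "Dom E (pb_pair E f x a b) = Dom E a"
    "Cod E (pb_pair E f x a b) = pb_obj E f x"
    "pb_proj E f x \<cdot> pb_pair E f x a b = a" "pb_top E f x \<cdot> pb_pair E f x a b = b"
  using theI'[OF pb_universal[OF assms]] by (auto simp: pb_pair_def hom_def)

lemma pb_pair_comp [simp]:
  assumes "f \<in> Arr E" "x \<in> Arr E" "Cod E f = Cod E x"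
    "a \<in> Arr E" "b \<in> Arr E" "Dom E a = Dom E b" "Cod E a = Dom E f" "Cod E b = Dom E x"
    "f \<cdot> a = x \<cdot> b" "k \<in> Arr E" "Cod E k = Dom E a"
  shows "pb_proj E f x \<cdot> (pb_pair E f x a b \<cdot> k) = a \<cdot> k"
    "pb_top E f x \<cdot> (pb_pair E f x a b \<cdot> k) = b \<cdot> k"
  using assms comp_assoc[of k "pb_pair E f x a b" "pb_proj E f x"]
    comp_assoc[of k "pb_pair E f x a b" "pb_top E f x"] by (simp_all del: comp_assoc)

lemma pb_eqI:
  assumes "f \<in> Arr E" "x \<in> Arr E" "Cod E f = Cod E x"
    and "u \<in> Arr E" "v \<in> Arr E" "Dom E u = Dom E v"
    "Cod E u = pb_obj E f x" "Cod E v = pb_obj E f x"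
    and "pb_proj E f x \<cdot> u = pb_proj E f x \<cdot> v" "pb_top E f x \<cdot> u = pb_top E f x \<cdot> v"
  shows "u = v"
proof -
  have "\<exists>!h. h \<in> hom E (Dom E (pb_proj E f x \<cdot> v)) (pb_obj E f x) \<and>
      pb_proj E f x \<cdot> h = pb_proj E f x \<cdot> v \<and> pb_top E f x \<cdot> h = pb_top E f x \<cdot> v"
    by (rule pb_universal) (use assms in simp_all)
  moreover have "u \<in> hom E (Dom E (pb_proj E f x \<cdot> v)) (pb_obj E f x)"
    "v \<in> hom E (Dom E (pb_proj E f x \<cdot> v)) (pb_obj E f x)"
    using assms by (simp_all add: hom_def)
  ultimately show ?thesis using assms(9,10) by blast
qed

lemma pb_pair_precomp:
  assumes "f \<in> Arr E" "x \<in> Arr E" "Cod E f = Cod E x"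
    "a \<in> Arr E" "b \<in> Arr E" "Dom E a = Dom E b" "Cod E a = Dom E f" "Cod E b = Dom E x"
    "f \<cdot> a = x \<cdot> b" "k \<in> Arr E" "Cod E k = Dom E a"
  shows "pb_pair E f x a b \<cdot> k = pb_pair E f x (a \<cdot> k) (b \<cdot> k)"
proof -
  have eq: "f \<cdot> (a \<cdot> k) = x \<cdot> (b \<cdot> k)"
    using assms comp_assoc[of k a f] comp_assoc[of k b x] by simp
  show ?thesis by (rule pb_eqI[of f x]) (use assms eq in simp_all)
qed

lemma pb_pair_eta:
  assumes "f \<in> Arr E" "x \<in> Arr E" "Cod E f = Cod E x"
  shows "pb_pair E f x (pb_proj E f x) (pb_top E f x) = Ident E (pb_obj E f x)"
  by (rule pb_eqI[of f x]) (use assms in simp_all)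


section \<open>Reindexing along a morphism of polynomials\<close>

abbreviation reindex_along :: "'a poly_map \<Rightarrow> 'a \<Rightarrow> 'a" where
  "reindex_along \<phi> f \<equiv> reindex E f (Fwd \<phi>) (PTgt \<phi>) (PSrc \<phi>) (Bwd \<phi>)"

lemma poly_map_arrows [simp]:
  assumes "is_poly_map E \<phi>"
  shows "PSrc \<phi> \<in> Arr E" "PTgt \<phi> \<in> Arr E"
    "Fwd \<phi> \<in> Arr E" "Dom E (Fwd \<phi>) = Cod E (PSrc \<phi>)" "Cod E (Fwd \<phi>) = Cod E (PTgt \<phi>)"
    "Bwd \<phi> \<in> Arr E" "Dom E (Bwd \<phi>) = pb_obj E (Fwd \<phi>) (PTgt \<phi>)"
    "Cod E (Bwd \<phi>) = Dom E (PSrc \<phi>)"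
    "PSrc \<phi> \<cdot> Bwd \<phi> = pb_proj E (Fwd \<phi>) (PTgt \<phi>)"
  using assms by (auto simp: is_poly_map_def hom_def)

lemma Bwd_over_comp [simp]:
  assumes "is_poly_map E \<phi>" "k \<in> Arr E" "Cod E k = pb_obj E (Fwd \<phi>) (PTgt \<phi>)"
  shows "PSrc \<phi> \<cdot> (Bwd \<phi> \<cdot> k) = pb_proj E (Fwd \<phi>) (PTgt \<phi>) \<cdot> k"
  using assms comp_assoc[of k "Bwd \<phi>" "PSrc \<phi>"] by (simp del: comp_assoc)

text \<open>For \<open>\<phi> : p \<rightarrow> q\<close>, the composite of \<open>pb_arr\<close> and \<open>pb_paste\<close> passes through \<open>f\<^sup>* (\<phi>\<^sub>1\<^sup>* q)\<close>.
  Describing it by its two projections eliminates that object, and is all that is needed of it below.\<close>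

lemma reindex_eq_pair:
  assumes "is_poly_map E \<phi>" "f \<in> Arr E" "Cod E f = Cod E (PSrc \<phi>)"
  shows "reindex_along \<phi> f =
    pb_pair E f (PSrc \<phi>) (pb_proj E (Fwd \<phi> \<cdot> f) (PTgt \<phi>))
      (Bwd \<phi> \<cdot> pb_pair E (Fwd \<phi>) (PTgt \<phi>)
        (f \<cdot> pb_proj E (Fwd \<phi> \<cdot> f) (PTgt \<phi>)) (pb_top E (Fwd \<phi> \<cdot> f) (PTgt \<phi>)))"
  unfolding reindex_def pb_arr_def pb_paste_def
  by (rule pb_eqI[of f "PSrc \<phi>"]) (use assms in simp_all)

lemma reindex_along [simp]:
  assumes "is_poly_map E \<phi>" "f \<in> Arr E" "Cod E f = Cod E (PSrc \<phi>)"
  shows "reindex_along \<phi> f \<in> Arr E"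
    "Dom E (reindex_along \<phi> f) = pb_obj E (Fwd \<phi> \<cdot> f) (PTgt \<phi>)"
    "Cod E (reindex_along \<phi> f) = pb_obj E f (PSrc \<phi>)"
    "pb_proj E f (PSrc \<phi>) \<cdot> reindex_along \<phi> f = pb_proj E (Fwd \<phi> \<cdot> f) (PTgt \<phi>)"
    "pb_top E f (PSrc \<phi>) \<cdot> reindex_along \<phi> f =
      Bwd \<phi> \<cdot> pb_pair E (Fwd \<phi>) (PTgt \<phi>)
        (f \<cdot> pb_proj E (Fwd \<phi> \<cdot> f) (PTgt \<phi>)) (pb_top E (Fwd \<phi> \<cdot> f) (PTgt \<phi>))"
  using assms by (simp_all add: reindex_eq_pair)

lemma reindex_along_comp [simp]:
  assumes "is_poly_map E \<phi>" "f \<in> Arr E" "Cod E f = Cod E (PSrc \<phi>)"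
    "k \<in> Arr E" "Cod E k = pb_obj E (Fwd \<phi> \<cdot> f) (PTgt \<phi>)"
  shows "pb_proj E f (PSrc \<phi>) \<cdot> (reindex_along \<phi> f \<cdot> k) = pb_proj E (Fwd \<phi> \<cdot> f) (PTgt \<phi>) \<cdot> k"
    "pb_top E f (PSrc \<phi>) \<cdot> (reindex_along \<phi> f \<cdot> k) =
      Bwd \<phi> \<cdot> pb_pair E (Fwd \<phi>) (PTgt \<phi>)
        (f \<cdot> pb_proj E (Fwd \<phi> \<cdot> f) (PTgt \<phi>) \<cdot> k) (pb_top E (Fwd \<phi> \<cdot> f) (PTgt \<phi>) \<cdot> k)"
  using assms by (simp_all add: reindex_eq_pair pb_pair_precomp)

lemma poly_id_simps [simp]:
  "PSrc (poly_id E p) = p" "PTgt (poly_id E p) = p" "Fwd (poly_id E p) = Ident E (Cod E p)"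
  "Bwd (poly_id E p) = pb_top E (Ident E (Cod E p)) p"
  by (simp_all add: poly_id_def)

lemma poly_comp_simps [simp]:
  "PSrc (poly_comp E \<chi> \<phi>) = PSrc \<phi>" "PTgt (poly_comp E \<chi> \<phi>) = PTgt \<chi>"
  "Fwd (poly_comp E \<chi> \<phi>) = Fwd \<chi> \<cdot> Fwd \<phi>"
  "Bwd (poly_comp E \<chi> \<phi>) = Bwd \<phi> \<cdot> reindex_along \<chi> (Fwd \<phi>)"
  by (simp_all add: poly_comp_def)

lemma is_poly_map_id [simp]: "p \<in> Arr E \<Longrightarrow> is_poly_map E (poly_id E p)"
  by (simp add: is_poly_map_def hom_def)

lemma is_poly_map_comp [simp]:
  assumes "is_poly_map E \<phi>" "is_poly_map E \<chi>" "PTgt \<phi> = PSrc \<chi>"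
  shows "is_poly_map E (poly_comp E \<chi> \<phi>)"
  using assms by (simp add: is_poly_map_def[of E "poly_comp E \<chi> \<phi>"] hom_def)

lemma reindex_along_id:
  assumes "p \<in> Arr E" "f \<in> Arr E" "Cod E f = Cod E p"
  shows "reindex_along (poly_id E p) f = Ident E (pb_obj E f p)"
proof (rule pb_eqI[of f p])
  show "pb_top E f p \<cdot> reindex_along (poly_id E p) f = pb_top E f p \<cdot> Ident E (pb_obj E f p)"
    using assms reindex_along(5)[of "poly_id E p" f] by simp
qed (use assms reindex_along(1-4)[of "poly_id E p" f] in simp_all)

text \<open>Let \<open>\<phi> : p \<rightarrow> q\<close>. Both sides have the same projection to the domain of \<open>f\<close>. Their
  projections to the total space of \<open>p\<close> are \<open>\<phi>\<^sup>#\<close> after two arrows into \<open>\<phi>\<^sub>1\<^sup>* q\<close>, so the claim reduces to the naturality of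
  reindexing along \<open>\<chi>\<close> under the change of base by \<open>f\<close>, which is again checked on projections.\<close>

lemma reindex_along_poly_comp:
  assumes "is_poly_map E \<phi>" "is_poly_map E \<chi>" "PTgt \<phi> = PSrc \<chi>"
    "f \<in> Arr E" "Cod E f = Cod E (PSrc \<phi>)"
  shows "reindex_along (poly_comp E \<chi> \<phi>) f =
    reindex_along \<phi> f \<cdot> reindex_along \<chi> (Fwd \<phi> \<cdot> f)"
proof -
  let ?q = "PTgt \<phi>" and ?r = "PTgt \<chi>" and ?h = "Fwd \<chi> \<cdot> Fwd \<phi> \<cdot> f"
  have inner: "reindex_along \<chi> (Fwd \<phi>) \<cdot>
        pb_pair E (Fwd \<chi> \<cdot> Fwd \<phi>) ?r (f \<cdot> pb_proj E ?h ?r) (pb_top E ?h ?r) =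
      pb_pair E (Fwd \<phi>) ?q (f \<cdot> pb_proj E (Fwd \<phi> \<cdot> f) ?q) (pb_top E (Fwd \<phi> \<cdot> f) ?q) \<cdot>
        reindex_along \<chi> (Fwd \<phi> \<cdot> f)"
    by (rule pb_eqI[of "Fwd \<phi>" ?q]) (use assms in simp_all)
  note whole = reindex_along[of "poly_comp E \<chi> \<phi>" f]
    and parts = reindex_along[of \<phi> f]
      reindex_along_comp[of \<phi> f "reindex_along \<chi> (Fwd \<phi> \<cdot> f)"]
  show ?thesis
  proof (rule pb_eqI[of f "PSrc \<phi>"])
    show "pb_top E f (PSrc \<phi>) \<cdot> reindex_along (poly_comp E \<chi> \<phi>) f =
      pb_top E f (PSrc \<phi>) \<cdot> (reindex_along \<phi> f \<cdot> reindex_along \<chi> (Fwd \<phi> \<cdot> f))"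
      using assms whole(5) parts inner by (simp add: pb_pair_precomp)
  qed (use assms whole(1-4) parts in simp_all)
qed

lemma pb_section [simp]:
  assumes "f \<in> Arr E" "p \<in> Arr E" "Cod E f = Cod E p" "poly_section E p \<sigma>"
  shows "pb_section E f p \<sigma> \<in> Arr E" "Dom E (pb_section E f p \<sigma>) = Dom E f"
    "Cod E (pb_section E f p \<sigma>) = pb_obj E f p"
    "pb_proj E f p \<cdot> pb_section E f p \<sigma> = Ident E (Dom E f)"
    "pb_top E f p \<cdot> pb_section E f p \<sigma> = \<sigma> \<cdot> f"
proof -
  have \<sigma>: "\<sigma> \<in> Arr E" "Dom E \<sigma> = Cod E p" "Cod E \<sigma> = Dom E p" "p \<cdot> \<sigma> = Ident E (Cod E p)"
    using assms(4) by (auto simp: poly_section_def hom_def)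
  have "p \<cdot> (\<sigma> \<cdot> f) = f"
    using assms \<sigma> comp_assoc[of f \<sigma> p] by (simp del: comp_assoc)
  with assms \<sigma> show "pb_section E f p \<sigma> \<in> Arr E" "Dom E (pb_section E f p \<sigma>) = Dom E f"
    "Cod E (pb_section E f p \<sigma>) = pb_obj E f p"
    "pb_proj E f p \<cdot> pb_section E f p \<sigma> = Ident E (Dom E f)"
    "pb_top E f p \<cdot> pb_section E f p \<sigma> = \<sigma> \<cdot> f"
    by (simp_all add: pb_section_def)
qed

text \<open>The section \<open>\<phi>\<^sup># \<circ> \<phi>\<^sub>1\<^sup>* \<sigma>\<close> of the source of \<open>\<phi>\<close>, for a section \<open>\<sigma>\<close> of its target.\<close>

definition pull_section :: "'a poly_map \<Rightarrow> 'a \<Rightarrow> 'a" where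
  "pull_section \<phi> \<sigma> = Bwd \<phi> \<cdot> pb_section E (Fwd \<phi>) (PTgt \<phi>) \<sigma>"

lemma poly_section_pull_section:
  assumes "is_poly_map E \<phi>" "poly_section E (PTgt \<phi>) \<sigma>"
  shows "poly_section E (PSrc \<phi>) (pull_section \<phi> \<sigma>)"
  using assms by (simp add: poly_section_def[of E "PSrc \<phi>"] pull_section_def hom_def)

text \<open>After projection to the total space of the source of \<open>\<phi>\<close>, both sides are \<open>\<phi>\<^sup># \<circ> \<phi>\<^sub>1\<^sup>* \<sigma> \<circ> f\<close>:
  pulling back \<open>\<sigma>\<close> along \<open>\<phi>\<^sub>1 \<circ> f\<close> is the same as precomposing \<open>\<phi>\<^sub>1\<^sup>* \<sigma>\<close> with \<open>f\<close>.\<close>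

lemma reindex_along_section:
  assumes "is_poly_map E \<phi>" "poly_section E (PTgt \<phi>) \<sigma>" "f \<in> Arr E" "Cod E f = Cod E (PSrc \<phi>)"
  shows "reindex_along \<phi> f \<cdot> pb_section E (Fwd \<phi> \<cdot> f) (PTgt \<phi>) \<sigma> =
    pb_section E f (PSrc \<phi>) (pull_section \<phi> \<sigma>)"
proof -
  have \<sigma>: "\<sigma> \<in> Arr E" "Dom E \<sigma> = Cod E (PTgt \<phi>)" "Cod E \<sigma> = Dom E (PTgt \<phi>)"
    "PTgt \<phi> \<cdot> \<sigma> = Ident E (Cod E (PTgt \<phi>))"
    using assms(2) by (auto simp: poly_section_def hom_def)
  have \<sigma>_comp: "PTgt \<phi> \<cdot> (\<sigma> \<cdot> k) = k" if "k \<in> Arr E" "Cod E k = Cod E (PTgt \<phi>)" for k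
    using that \<sigma> assms comp_assoc[of k \<sigma> "PTgt \<phi>"] by (simp del: comp_assoc)
  have "pb_pair E (Fwd \<phi>) (PTgt \<phi>) f (\<sigma> \<cdot> Fwd \<phi> \<cdot> f) =
      pb_section E (Fwd \<phi>) (PTgt \<phi>) \<sigma> \<cdot> f"
    using assms \<sigma> \<sigma>_comp
      pb_pair_precomp[of "Fwd \<phi>" "PTgt \<phi>" "Ident E (Cod E (PSrc \<phi>))" "\<sigma> \<cdot> Fwd \<phi>" f]
    by (simp add: pb_section_def)
  then have key: "Bwd \<phi> \<cdot> pb_pair E (Fwd \<phi>) (PTgt \<phi>) f (\<sigma> \<cdot> Fwd \<phi> \<cdot> f) = pull_section \<phi> \<sigma> \<cdot> f"
    using assms by (simp add: pull_section_def)
  note pulled = poly_section_pull_section[OF assms(1,2)]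
  show ?thesis
  proof (rule pb_eqI[of f "PSrc \<phi>"])
    show "pb_top E f (PSrc \<phi>) \<cdot> (reindex_along \<phi> f \<cdot> pb_section E (Fwd \<phi> \<cdot> f) (PTgt \<phi>) \<sigma>) =
      pb_top E f (PSrc \<phi>) \<cdot> pb_section E f (PSrc \<phi>) (pull_section \<phi> \<sigma>)"
      using assms pulled key by simp
  qed (use assms pulled in simp_all)
qed

section \<open>The category of polynomials\<close>

lemma category_Poly: "category (Poly E)"
proof -
  \<comment> \<open>The forward parts obey the category laws of \<open>E\<close>; the backward parts obey the laws of
    reindexing, the base change being the forward part of the map that is applied first.\<close>
  have left_id: "poly_comp E (poly_id E (PTgt \<phi>)) \<phi> = \<phi>" if "is_poly_map E \<phi>" for \<phi>
    using that reindex_along_id[of "PTgt \<phi>" "Fwd \<phi>"]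
    by (intro poly_map.equality) simp_all
  have right_id: "poly_comp E \<phi> (poly_id E (PSrc \<phi>)) = \<phi>" if "is_poly_map E \<phi>" for \<phi>
    using that reindex_along[of \<phi> "Ident E (Cod E (PSrc \<phi>))"]
    by (intro poly_map.equality) (simp_all add: pb_pair_eta)
  have assoc: "poly_comp E (poly_comp E \<omega> \<chi>) \<phi> = poly_comp E \<omega> (poly_comp E \<chi> \<phi>)"
    if "is_poly_map E \<phi>" "is_poly_map E \<chi>" "is_poly_map E \<omega>"
      "PTgt \<phi> = PSrc \<chi>" "PTgt \<chi> = PSrc \<omega>" for \<phi> \<chi> \<omega>
    using that reindex_along_poly_comp[of \<chi> \<omega> "Fwd \<phi>"] reindex_along[of \<chi> "Fwd \<phi>"]
    by (intro poly_map.equality) simp_all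
  show ?thesis
  proof (rule categoryI)
    fix p q r s \<phi> \<chi> \<omega>
    assume "\<phi> \<in> hom (Poly E) p q" "\<chi> \<in> hom (Poly E) q r" "\<omega> \<in> hom (Poly E) r s"
    then show "(\<omega> \<cdot>\<^bsub>Poly E\<^esub> \<chi>) \<cdot>\<^bsub>Poly E\<^esub> \<phi> = \<omega> \<cdot>\<^bsub>Poly E\<^esub> (\<chi> \<cdot>\<^bsub>Poly E\<^esub> \<phi>)"
      using assoc[of \<phi> \<chi> \<omega>] by (simp add: Poly_def hom_def)
  next
    fix p q \<phi>
    assume "\<phi> \<in> hom (Poly E) p q"
    then show "\<phi> \<cdot>\<^bsub>Poly E\<^esub> Ident (Poly E) p = \<phi>" "Ident (Poly E) q \<cdot>\<^bsub>Poly E\<^esub> \<phi> = \<phi>"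
      using left_id[of \<phi>] right_id[of \<phi>] by (auto simp: Poly_def hom_def)
  qed (auto simp: Poly_def hom_def)
qed

end

section \<open>Products\<close>

locale finite_limit_category = pullback_category E for E :: "('o, 'a) cat" (structure) +
  assumes products_exist: "A \<in> Obj E \<Longrightarrow> B \<in> Obj E \<Longrightarrow> \<exists>P p1 p2. is_product E A B P p1 p2"
begin

lemma product_is_product:
  assumes "A \<in> Obj E" "B \<in> Obj E"
  shows "is_product E A B (prod_obj E A B) (prod_fst E A B) (prod_snd E A B)"
proof -
  have "case product E A B of (P, p1, p2) \<Rightarrow> is_product E A B P p1 p2"
    unfolding product_def
    by (rule someI_ex) (use products_exist[OF assms] in auto)
  then show ?thesis by (simp add: prod_obj_def prod_fst_def prod_snd_def split_beta)
qed

lemma prod_arrows [simp]: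
  assumes "A \<in> Obj E" "B \<in> Obj E"
  shows "prod_fst E A B \<in> Arr E" "Dom E (prod_fst E A B) = prod_obj E A B"
    "Cod E (prod_fst E A B) = A"
    "prod_snd E A B \<in> Arr E" "Dom E (prod_snd E A B) = prod_obj E A B"
    "Cod E (prod_snd E A B) = B"
    "prod_obj E A B \<in> Obj E"
proof -
  show *: "prod_fst E A B \<in> Arr E" "Dom E (prod_fst E A B) = prod_obj E A B"
    "Cod E (prod_fst E A B) = A"
    "prod_snd E A B \<in> Arr E" "Dom E (prod_snd E A B) = prod_obj E A B"
    "Cod E (prod_snd E A B) = B"
    using product_is_product[OF assms] by (auto simp: is_product_def hom_def)
  show "prod_obj E A B \<in> Obj E" using dom_obj[OF *(1)] *(2) by simp
qed

lemma prod_universal: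
  assumes "f \<in> Arr E" "g \<in> Arr E" "Dom E f = Dom E g"
  shows "\<exists>!h. h \<in> hom E (Dom E f) (prod_obj E (Cod E f) (Cod E g)) \<and>
    prod_fst E (Cod E f) (Cod E g) \<cdot> h = f \<and> prod_snd E (Cod E f) (Cod E g) \<cdot> h = g"
proof -
  have "f \<in> hom E (Dom E f) (Cod E f)" "g \<in> hom E (Dom E f) (Cod E g)"
    using assms by (auto simp: hom_def)
  then show ?thesis
    using product_is_product[of "Cod E f" "Cod E g"] assms unfolding is_product_def by simp
qed

lemma prod_pair [simp]:
  assumes "f \<in> Arr E" "g \<in> Arr E" "Dom E f = Dom E g"
  shows "prod_pair E f g \<in> Arr E" "Dom E (prod_pair E f g) = Dom E f"
    "Cod E (prod_pair E f g) = prod_obj E (Cod E f) (Cod E g)"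
    "A = Cod E f \<Longrightarrow> B = Cod E g \<Longrightarrow> prod_fst E A B \<cdot> prod_pair E f g = f"
    "A = Cod E f \<Longrightarrow> B = Cod E g \<Longrightarrow> prod_snd E A B \<cdot> prod_pair E f g = g"
  using theI'[OF prod_universal[OF assms]] by (auto simp: prod_pair_def hom_def)

lemma prod_eqI:
  assumes "A \<in> Obj E" "B \<in> Obj E"
    and "u \<in> Arr E" "v \<in> Arr E" "Dom E u = Dom E v"
    "Cod E u = prod_obj E A B" "Cod E v = prod_obj E A B"
    and "prod_fst E A B \<cdot> u = prod_fst E A B \<cdot> v" "prod_snd E A B \<cdot> u = prod_snd E A B \<cdot> v"
  shows "u = v"
proof -
  have "\<exists>!h. h \<in> hom E (Dom E v) (prod_obj E A B) \<and>
      prod_fst E A B \<cdot> h = prod_fst E A B \<cdot> v \<and> prod_snd E A B \<cdot> h = prod_snd E A B \<cdot> v"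
    using prod_universal[of "prod_fst E A B \<cdot> v" "prod_snd E A B \<cdot> v"] assms by simp
  moreover have "u \<in> hom E (Dom E v) (prod_obj E A B)" "v \<in> hom E (Dom E v) (prod_obj E A B)"
    using assms by (simp_all add: hom_def)
  ultimately show ?thesis using assms(8,9) by blast
qed

lemma prod_arr [simp]:
  assumes "f \<in> Arr E" "g \<in> Arr E"
  shows "prod_arr E f g \<in> Arr E" "Dom E (prod_arr E f g) = prod_obj E (Dom E f) (Dom E g)"
    "Cod E (prod_arr E f g) = prod_obj E (Cod E f) (Cod E g)"
    "A = Cod E f \<Longrightarrow> B = Cod E g \<Longrightarrow>
      prod_fst E A B \<cdot> prod_arr E f g = f \<cdot> prod_fst E (Dom E f) (Dom E g)"
    "A = Cod E f \<Longrightarrow> B = Cod E g \<Longrightarrow>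
      prod_snd E A B \<cdot> prod_arr E f g = g \<cdot> prod_snd E (Dom E f) (Dom E g)"
  using assms by (simp_all add: prod_arr_def)

lemma prod_arr_comp_proj [simp]:
  assumes "f \<in> Arr E" "g \<in> Arr E" "k \<in> Arr E" "Cod E k = prod_obj E (Dom E f) (Dom E g)"
    "A = Cod E f" "B = Cod E g"
  shows "prod_fst E A B \<cdot> (prod_arr E f g \<cdot> k) = f \<cdot> (prod_fst E (Dom E f) (Dom E g) \<cdot> k)"
    "prod_snd E A B \<cdot> (prod_arr E f g \<cdot> k) = g \<cdot> (prod_snd E (Dom E f) (Dom E g) \<cdot> k)"
proof -
  show "prod_fst E A B \<cdot> (prod_arr E f g \<cdot> k) = f \<cdot> (prod_fst E (Dom E f) (Dom E g) \<cdot> k)"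
    using assms comp_assoc[of k "prod_arr E f g" "prod_fst E A B", symmetric]
      comp_assoc[of k "prod_fst E (Dom E f) (Dom E g)" f] by (simp del: comp_assoc)
  show "prod_snd E A B \<cdot> (prod_arr E f g \<cdot> k) = g \<cdot> (prod_snd E (Dom E f) (Dom E g) \<cdot> k)"
    using assms comp_assoc[of k "prod_arr E f g" "prod_snd E A B", symmetric]
      comp_assoc[of k "prod_snd E (Dom E f) (Dom E g)" g] by (simp del: comp_assoc)
qed

lemma prod_arr_ident:
  assumes "A \<in> Obj E" "B \<in> Obj E"
  shows "prod_arr E (Ident E A) (Ident E B) = Ident E (prod_obj E A B)"
  by (rule prod_eqI[of A B]) (use assms in simp_all)

lemma prod_arr_comp:
  assumes "f \<in> Arr E" "g \<in> Arr E" "f' \<in> Arr E" "g' \<in> Arr E"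
    "Cod E f = Dom E f'" "Cod E g = Dom E g'"
  shows "prod_arr E f' g' \<cdot> prod_arr E f g = prod_arr E (f' \<cdot> f) (g' \<cdot> g)"
  by (rule prod_eqI[of "Cod E f'" "Cod E g'"]) (use assms in simp_all)

end

section \<open>Open dynamical systems and change of interface\<close>

locale timed_category = finite_limit_category E for E :: "('o, 'a) cat" (structure) +
  fixes T :: 'o and \<mu> \<eta> :: 'a
  assumes time_obj [simp]: "T \<in> Obj E"
begin

lemma dyn_sys_arrows:
  assumes "is_dyn_sys E T \<mu> \<eta> p (S, out, upd)"
  shows "S \<in> Obj E" "out \<in> Arr E" "Dom E out = prod_obj E T S" "Cod E out = Cod E p"
    "upd \<in> Arr E" "Dom E upd = pb_obj E out p" "Cod E upd = S"
  using assms by (auto simp: is_dyn_sys_def hom_def)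

lemma state_obj [simp]: "is_dyn_sys E T \<mu> \<eta> p \<theta> \<Longrightarrow> fst \<theta> \<in> Obj E"
  by (cases \<theta>) (simp add: dyn_sys_arrows)

lemma sys_closure_arr [simp]:
  assumes "p \<in> Arr E" "is_dyn_sys E T \<mu> \<eta> p \<theta>" "poly_section E p \<sigma>"
  shows "sys_closure E p \<theta> \<sigma> \<in> Arr E" "Dom E (sys_closure E p \<theta> \<sigma>) = prod_obj E T (fst \<theta>)"
    "Cod E (sys_closure E p \<theta> \<sigma>) = fst \<theta>"
  using assms by (cases \<theta>; simp add: sys_closure_def dyn_sys_arrows)+

lemma dyn_map_arr:
  assumes "is_dyn_map E T p \<theta> f \<psi>"
  shows "f \<in> Arr E" "Dom E f = fst \<theta>" "Cod E f = fst \<psi>"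
  using assms by (auto simp: is_dyn_map_def hom_def)

lemma dyn_map_ident:
  assumes "p \<in> Arr E" "is_dyn_sys E T \<mu> \<eta> p \<theta>"
  shows "is_dyn_map E T p \<theta> (Ident E (fst \<theta>)) \<theta>"
  using assms by (simp add: is_dyn_map_def hom_def prod_arr_ident)

text \<open>For each section, the commuting squares of \<open>f\<close> and \<open>g\<close> paste along the closure of \<open>\<psi>\<close>.\<close>

lemma dyn_map_comp:
  assumes "p \<in> Arr E" "is_dyn_sys E T \<mu> \<eta> p \<theta>" "is_dyn_sys E T \<mu> \<eta> p \<psi>"
    "is_dyn_sys E T \<mu> \<eta> p \<xi>"
    and f: "is_dyn_map E T p \<theta> f \<psi>" and g: "is_dyn_map E T p \<psi> g \<xi>"
  shows "is_dyn_map E T p \<theta> (g \<cdot> f) \<xi>"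
  unfolding is_dyn_map_def
proof (intro conjI allI impI)
  note arr = dyn_map_arr[OF f] dyn_map_arr[OF g]
  show "g \<cdot> f \<in> hom E (fst \<theta>) (fst \<xi>)" using arr by (simp add: hom_def)
  fix \<sigma> assume \<sigma>: "poly_section E p \<sigma>"
  let ?\<theta> = "sys_closure E p \<theta> \<sigma>" and ?\<psi> = "sys_closure E p \<psi> \<sigma>" and ?\<xi> = "sys_closure E p \<xi> \<sigma>"
  let ?f = "prod_arr E (Ident E T) f" and ?g = "prod_arr E (Ident E T) g"
  have "f \<cdot> ?\<theta> = ?\<psi> \<cdot> ?f" "g \<cdot> ?\<psi> = ?\<xi> \<cdot> ?g"
    using f g \<sigma> by (auto simp: is_dyn_map_def)
  then have "(g \<cdot> f) \<cdot> ?\<theta> = (?\<xi> \<cdot> ?g) \<cdot> ?f"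
    using assms(1-4) \<sigma> arr comp_assoc[of ?f ?\<psi> g] by simp
  also have "\<dots> = ?\<xi> \<cdot> prod_arr E (Ident E T) (g \<cdot> f)"
    using assms(1-4) \<sigma> arr by (simp add: prod_arr_comp)
  finally show "(g \<cdot> f) \<cdot> ?\<theta> = ?\<xi> \<cdot> prod_arr E (Ident E T) (g \<cdot> f)" .
qed

lemma category_Dyn:
  assumes "p \<in> Arr E"
  shows "category (Dyn E T \<mu> \<eta> p)"
proof (rule categoryI)
  fix A B f
  assume "f \<in> hom (Dyn E T \<mu> \<eta> p) A B"
  then show "f \<cdot>\<^bsub>Dyn E T \<mu> \<eta> p\<^esub> Ident (Dyn E T \<mu> \<eta> p) A = f"
    "Ident (Dyn E T \<mu> \<eta> p) B \<cdot>\<^bsub>Dyn E T \<mu> \<eta> p\<^esub> f = f"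
    by (auto simp: Dyn_def hom_def dyn_map_arr)
next
  fix A B D F f g h
  assume "f \<in> hom (Dyn E T \<mu> \<eta> p) A B" "g \<in> hom (Dyn E T \<mu> \<eta> p) B D"
    "h \<in> hom (Dyn E T \<mu> \<eta> p) D F"
  then show "(h \<cdot>\<^bsub>Dyn E T \<mu> \<eta> p\<^esub> g) \<cdot>\<^bsub>Dyn E T \<mu> \<eta> p\<^esub> f = h \<cdot>\<^bsub>Dyn E T \<mu> \<eta> p\<^esub> (g \<cdot>\<^bsub>Dyn E T \<mu> \<eta> p\<^esub> f)"
    by (auto simp: Dyn_def hom_def dyn_map_arr)
qed (use assms in \<open>auto simp: Dyn_def hom_def dyn_map_ident intro: dyn_map_comp\<close>)

definition change_interface :: "'a poly_map \<Rightarrow> ('o, 'a) dyn_sys \<Rightarrow> ('o, 'a) dyn_sys" where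
  "change_interface \<phi> = (\<lambda>(X, out, upd). (X, Fwd \<phi> \<cdot> out, upd \<cdot> reindex_along \<phi> out))"

lemma fst_change_interface [simp]: "fst (change_interface \<phi> \<theta>) = fst \<theta>"
  by (simp add: change_interface_def split_beta)

text \<open>This equation transports every condition on closures from the source of \<open>\<phi>\<close> to its target.
  For a system \<open>(S, out, upd)\<close> with interface \<open>p\<close>, both closures are \<open>upd\<close> after an arrow \<open>T \<times> S \<rightarrow> out\<^sup>* p\<close>, and the two arrows agree by
  \<open>reindex_along_section\<close>.\<close>

lemma sys_closure_change_interface:
  assumes "is_poly_map E \<phi>" "is_dyn_sys E T \<mu> \<eta> (PSrc \<phi>) \<theta>" "poly_section E (PTgt \<phi>) \<sigma>"
  shows "sys_closure E (PTgt \<phi>) (change_interface \<phi> \<theta>) \<sigma> =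
    sys_closure E (PSrc \<phi>) \<theta> (pull_section \<phi> \<sigma>)"
proof (cases \<theta>)
  case (fields S out upd)
  note arr = dyn_sys_arrows[OF assms(2)[unfolded fields]]
  show ?thesis
    using assms(1,3) arr reindex_along_section[of \<phi> \<sigma> out]
    by (simp add: fields change_interface_def sys_closure_def)
qed

lemma is_dyn_sys_change_interface:
  assumes "is_poly_map E \<phi>" "is_dyn_sys E T \<mu> \<eta> (PSrc \<phi>) \<theta>"
  shows "is_dyn_sys E T \<mu> \<eta> (PTgt \<phi>) (change_interface \<phi> \<theta>)"
proof (cases \<theta>)
  case (fields S out upd)
  note arr = dyn_sys_arrows[OF assms(2)[unfolded fields]]
  have "is_flow E T \<mu> \<eta> S (sys_closure E (PTgt \<phi>) (change_interface \<phi> \<theta>) \<sigma>)"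
    if "poly_section E (PTgt \<phi>) \<sigma>" for \<sigma>
    using poly_section_pull_section[OF assms(1) that] assms(2)
    unfolding sys_closure_change_interface[OF assms that] by (simp add: fields is_dyn_sys_def)
  then show ?thesis
    using assms(1) arr by (simp add: fields change_interface_def is_dyn_sys_def hom_def)
qed

lemma is_dyn_map_change_interface:
  assumes "is_poly_map E \<phi>" "is_dyn_sys E T \<mu> \<eta> (PSrc \<phi>) \<theta>" "is_dyn_sys E T \<mu> \<eta> (PSrc \<phi>) \<psi>"
    and "is_dyn_map E T (PSrc \<phi>) \<theta> f \<psi>"
  shows "is_dyn_map E T (PTgt \<phi>) (change_interface \<phi> \<theta>) f (change_interface \<phi> \<psi>)"
  using assms poly_section_pull_section[OF assms(1)]
  by (simp add: is_dyn_map_def sys_closure_change_interface)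

lemma change_interface_poly_id:
  assumes "p \<in> Arr E" "is_dyn_sys E T \<mu> \<eta> p \<theta>"
  shows "change_interface (poly_id E p) \<theta> = \<theta>"
proof (cases \<theta>)
  case (fields S out upd)
  then show ?thesis
    using assms dyn_sys_arrows[OF assms(2)[unfolded fields]] reindex_along_id[of p out]
    by (simp add: change_interface_def)
qed

lemma change_interface_poly_comp:
  assumes "is_poly_map E \<phi>" "is_poly_map E \<chi>" "PTgt \<phi> = PSrc \<chi>"
    "is_dyn_sys E T \<mu> \<eta> (PSrc \<phi>) \<theta>"
  shows "change_interface (poly_comp E \<chi> \<phi>) \<theta> = change_interface \<chi> (change_interface \<phi> \<theta>)"
proof (cases \<theta>)
  case (fields S out upd)
  then show ?thesis
    using assms dyn_sys_arrows[OF assms(4)[unfolded fields]]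
      reindex_along_poly_comp[of \<phi> \<chi> out] reindex_along[of \<phi> out]
    by (simp add: change_interface_def)
qed

definition dyn_functor ::
  "'a poly_map \<Rightarrow> (('o, 'a) dyn_sys, ('o, 'a) dyn_sys \<times> 'a \<times> ('o, 'a) dyn_sys,
     ('o, 'a) dyn_sys, ('o, 'a) dyn_sys \<times> 'a \<times> ('o, 'a) dyn_sys) functor_data" where
  "dyn_functor \<phi> =
     \<lparr>Src = Dyn E T \<mu> \<eta> (PSrc \<phi>), Tgt = Dyn E T \<mu> \<eta> (PTgt \<phi>),
      OMap = restrict (change_interface \<phi>) (Obj (Dyn E T \<mu> \<eta> (PSrc \<phi>))),
      AMap = restrict (\<lambda>(\<theta>, f, \<psi>). (change_interface \<phi> \<theta>, f, change_interface \<phi> \<psi>))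
        (Arr (Dyn E T \<mu> \<eta> (PSrc \<phi>)))\<rparr>"

lemma is_functor_dyn_functor:
  assumes "is_poly_map E \<phi>"
  shows "is_functor (dyn_functor \<phi>)"
proof (rule is_functorI)
  let ?F = "dyn_functor \<phi>" and ?P = "Dyn E T \<mu> \<eta> (PSrc \<phi>)"
  have cat: "category ?P" "category (Dyn E T \<mu> \<eta> (PTgt \<phi>))"
    using assms by (simp_all add: category_Dyn)
  then show "category (Src ?F)" "category (Tgt ?F)"
    by (simp_all add: dyn_functor_def)
  show "OMap ?F \<in> extensional (Obj (Src ?F))" "AMap ?F \<in> extensional (Arr (Src ?F))"
    by (simp_all add: dyn_functor_def)
  show "OMap ?F A \<in> Obj (Tgt ?F)" if "A \<in> Obj (Src ?F)" for A
    using that assms is_dyn_sys_change_interface[of \<phi> A] by (simp add: dyn_functor_def Dyn_def)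
  show "AMap ?F f \<in> hom (Tgt ?F) (OMap ?F A) (OMap ?F B)" if "f \<in> hom (Src ?F) A B" for A B f
    using that assms
    by (auto simp: dyn_functor_def Dyn_def hom_def is_dyn_sys_change_interface
        is_dyn_map_change_interface)
  show "AMap ?F (Ident (Src ?F) A) = Ident (Tgt ?F) (OMap ?F A)" if "A \<in> Obj (Src ?F)" for A
    using that assms by (auto simp: dyn_functor_def Dyn_def dyn_map_ident)
  show "AMap ?F (g \<cdot>\<^bsub>Src ?F\<^esub> f) = AMap ?F g \<cdot>\<^bsub>Tgt ?F\<^esub> AMap ?F f"
    if "f \<in> hom (Src ?F) A B" "g \<in> hom (Src ?F) B D" for A B D f g
  proof -
    have "g \<cdot>\<^bsub>?P\<^esub> f \<in> hom ?P A D"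
      using categoryD(2)[OF cat(1)] that by (simp add: dyn_functor_def)
    with that show ?thesis
      by (auto simp: dyn_functor_def Dyn_def hom_def)
  qed
qed

lemma dyn_functor_poly_id:
  assumes "p \<in> Arr E"
  shows "dyn_functor (poly_id E p) = id_functor (Dyn E T \<mu> \<eta> p)"
  using assms change_interface_poly_id[OF assms]
  by (intro functor_data.equality)
    (auto simp: dyn_functor_def id_functor_def Dyn_def fun_eq_iff restrict_def)

lemma dyn_functor_poly_comp:
  assumes "is_poly_map E \<phi>" "is_poly_map E \<chi>" "PTgt \<phi> = PSrc \<chi>"
  shows "dyn_functor (poly_comp E \<chi> \<phi>) = comp_functor (dyn_functor \<chi>) (dyn_functor \<phi>)"
  using assms(3) change_interface_poly_comp[OF assms]
    is_dyn_sys_change_interface[OF assms(1)] is_dyn_map_change_interface[OF assms(1)]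
  by (intro functor_data.equality)
    (auto simp: dyn_functor_def comp_functor_def Dyn_def fun_eq_iff restrict_def compose_def)

definition dyn_indexed ::
  "('a, 'a poly_map,
    (('o, 'a) dyn_sys, ('o, 'a) dyn_sys \<times> 'a \<times> ('o, 'a) dyn_sys) cat,
    (('o, 'a) dyn_sys, ('o, 'a) dyn_sys \<times> 'a \<times> ('o, 'a) dyn_sys,
     ('o, 'a) dyn_sys, ('o, 'a) dyn_sys \<times> 'a \<times> ('o, 'a) dyn_sys) functor_data) functor_data"
where
  "dyn_indexed =
     \<lparr>Src = Poly E, Tgt = CAT, OMap = restrict (Dyn E T \<mu> \<eta>) (Arr E),
      AMap = restrict dyn_functor {\<phi>. is_poly_map E \<phi>}\<rparr>"

lemma is_functor_dyn_indexed: "is_functor dyn_indexed"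
proof (rule is_functorI)
  let ?D = "dyn_indexed"
  have ends: "Src ?D = Poly E" "Tgt ?D = CAT" by (simp_all add: dyn_indexed_def)
  show "category (Src ?D)" "category (Tgt ?D)"
    by (simp_all add: ends category_Poly category_CAT)
  show "OMap ?D \<in> extensional (Obj (Src ?D))" "AMap ?D \<in> extensional (Arr (Src ?D))"
    by (simp_all add: dyn_indexed_def Poly_def)
  show "OMap ?D p \<in> Obj (Tgt ?D)" if "p \<in> Obj (Src ?D)" for p
    using that category_Dyn[of p] by (simp add: dyn_indexed_def Poly_def CAT_def)
  show "AMap ?D \<phi> \<in> hom (Tgt ?D) (OMap ?D p) (OMap ?D q)" if "\<phi> \<in> hom (Src ?D) p q" for p q \<phi>
    using that is_functor_dyn_functor[of \<phi>] poly_map_arrows(1,2)[of \<phi>]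
    by (auto simp: dyn_indexed_def Poly_def CAT_def hom_def dyn_functor_def)
  show "AMap ?D (Ident (Src ?D) p) = Ident (Tgt ?D) (OMap ?D p)" if "p \<in> Obj (Src ?D)" for p
    using that by (simp add: dyn_indexed_def Poly_def CAT_def dyn_functor_poly_id)
  show "AMap ?D (\<chi> \<cdot>\<^bsub>Src ?D\<^esub> \<phi>) = AMap ?D \<chi> \<cdot>\<^bsub>Tgt ?D\<^esub> AMap ?D \<phi>"
    if "\<phi> \<in> hom (Src ?D) p q" "\<chi> \<in> hom (Src ?D) q r" for p q r \<phi> \<chi>
    using that by (simp add: dyn_indexed_def Poly_def CAT_def hom_def dyn_functor_poly_comp)
qed

end

section \<open>Finite limits in a locally Cartesian closed category\<close>

text \<open>A cone on the cospan \<open>(f, x)\<close> is a cone on the objects \<open>f\<close> and \<open>x\<close> of the slice, with vertex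
  the common composite \<open>c\<close> of the cone with \<open>f\<close> and with \<open>x\<close>. An arrow compatible with the legs
  lies over \<open>B\<close> automatically, so uniqueness in the slice gives uniqueness in \<open>E\<close>.\<close>

lemma slice_product_is_pullback:
  assumes cat: "category E" and fx: "f \<in> Arr E" "x \<in> Arr E" "Cod E f = B" "Cod E x = B"
    and prod: "is_product (slice E B) f x P p1 p2"
  shows "is_pullback E f x (Dom E P) (fst (snd p1)) (fst (snd p2))"
proof -
  let ?S = "slice E B" and ?h1 = "fst (snd p1)" and ?h2 = "fst (snd p2)"
  have legs: "p1 = (P, ?h1, f)" "?h1 \<in> hom E (Dom E P) (Dom E f)" "f \<cdot>\<^bsub>E\<^esub> ?h1 = P"
    "p2 = (P, ?h2, x)" "?h2 \<in> hom E (Dom E P) (Dom E x)" "x \<cdot>\<^bsub>E\<^esub> ?h2 = P"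
    "P \<in> Arr E" "Cod E P = B"
    using prod by (auto simp: is_product_def hom_def slice_def)
  have "\<exists>!h. h \<in> hom E X (Dom E P) \<and> ?h1 \<cdot>\<^bsub>E\<^esub> h = a \<and> ?h2 \<cdot>\<^bsub>E\<^esub> h = b"
    if a: "a \<in> hom E X (Dom E f)" and b: "b \<in> hom E X (Dom E x)"
      and eq: "f \<cdot>\<^bsub>E\<^esub> a = x \<cdot>\<^bsub>E\<^esub> b" for X a b
  proof -
    define c where "c = f \<cdot>\<^bsub>E\<^esub> a"
    have "f \<in> hom E (Dom E f) B" using fx by (simp add: hom_def)
    then have c: "c \<in> hom E X B" unfolding c_def using categoryD(2)[OF cat a] by blast
    have "(c, a, f) \<in> hom ?S c f" "(c, b, x) \<in> hom ?S c x"
      using a b c fx eq by (auto simp: slice_def hom_def c_def)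
    then have univ: "\<exists>!k. k \<in> hom ?S c P \<and> p1 \<cdot>\<^bsub>?S\<^esub> k = (c, a, f) \<and> p2 \<cdot>\<^bsub>?S\<^esub> k = (c, b, x)"
      using prod unfolding is_product_def by blast
    have lift: "(c, h, P) \<in> hom ?S c P \<and> p1 \<cdot>\<^bsub>?S\<^esub> (c, h, P) = (c, a, f) \<and>
        p2 \<cdot>\<^bsub>?S\<^esub> (c, h, P) = (c, b, x)"
      if h: "h \<in> hom E X (Dom E P)" "?h1 \<cdot>\<^bsub>E\<^esub> h = a" "?h2 \<cdot>\<^bsub>E\<^esub> h = b" for h
    proof -
      have "P \<cdot>\<^bsub>E\<^esub> h = c"
        using categoryD(5)[OF cat h(1) legs(2), of f B] fx legs(3) h(2)
        by (simp add: c_def hom_def)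
      moreover have "p1 \<cdot>\<^bsub>?S\<^esub> (c, h, P) = (c, a, f)"
        by (subst legs(1)) (simp add: slice_def h(2))
      moreover have "p2 \<cdot>\<^bsub>?S\<^esub> (c, h, P) = (c, b, x)"
        by (subst legs(4)) (simp add: slice_def h(3))
      ultimately show ?thesis
        using h(1) c legs(7,8) by (auto simp: slice_def hom_def)
    qed
    obtain k where k: "k \<in> hom ?S c P" "p1 \<cdot>\<^bsub>?S\<^esub> k = (c, a, f)" "p2 \<cdot>\<^bsub>?S\<^esub> k = (c, b, x)"
      using univ by blast
    obtain h where h: "k = (c, h, P)" "h \<in> hom E X (Dom E P)"
      using k(1) c by (auto simp: slice_def hom_def)
    have "?h1 \<cdot>\<^bsub>E\<^esub> h = a"
      using k(2) unfolding h(1) by (subst (asm) legs(1)) (simp add: slice_def)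
    moreover have "?h2 \<cdot>\<^bsub>E\<^esub> h = b"
      using k(3) unfolding h(1) by (subst (asm) legs(4)) (simp add: slice_def)
    ultimately show ?thesis
    proof (intro ex1I[of _ h])
      fix h' assume "h' \<in> hom E X (Dom E P) \<and> ?h1 \<cdot>\<^bsub>E\<^esub> h' = a \<and> ?h2 \<cdot>\<^bsub>E\<^esub> h' = b"
      then have "(c, h', P) = k" using univ lift[of h'] k by blast
      then show "h' = h" by (simp add: h(1))
    qed (use h(2) in auto)
  qed
  then show ?thesis
    unfolding is_pullback_def using fx legs by simp
qed

lemma pullback_over_terminal_is_product:
  assumes cat: "category E" and "is_terminal E U" "a \<in> hom E A U" "b \<in> hom E B U"
    and "is_pullback E a b P p1 p2"
  shows "is_product E A B P p1 p2"
proof -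
  have legs: "p1 \<in> hom E P A" "p2 \<in> hom E P B"
    using assms(3-5) by (auto simp: is_pullback_def hom_def)
  have "\<exists>!h. h \<in> hom E X P \<and> p1 \<cdot>\<^bsub>E\<^esub> h = f \<and> p2 \<cdot>\<^bsub>E\<^esub> h = g"
    if f: "f \<in> hom E X A" and g: "g \<in> hom E X B" for X f g
  proof -
    have "X \<in> Obj E" using f categoryD(3)[OF cat, of f] by (simp add: hom_def)
    then have "\<exists>!u. u \<in> hom E X U" using assms(2) by (simp add: is_terminal_def)
    moreover have "a \<cdot>\<^bsub>E\<^esub> f \<in> hom E X U" "b \<cdot>\<^bsub>E\<^esub> g \<in> hom E X U"
      using categoryD(2)[OF cat] f g assms(3,4) by blast+
    ultimately have "a \<cdot>\<^bsub>E\<^esub> f = b \<cdot>\<^bsub>E\<^esub> g" by blast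
    moreover have "f \<in> hom E X (Dom E a)" "g \<in> hom E X (Dom E b)"
      using f g assms(3,4) by (simp_all add: hom_def)
    ultimately show ?thesis using assms(5) unfolding is_pullback_def by blast
  qed
  with legs show ?thesis by (simp add: is_product_def)
qed

lemma finite_limit_category_of_lcc:
  assumes "locally_cartesian_closed E" "has_terminal E"
  shows "finite_limit_category E"
proof -
  have cat: "category E" using assms(1) by (simp add: locally_cartesian_closed_def)
  have pb: "\<exists>P p1 p2. is_pullback E f x P p1 p2"
    if "f \<in> Arr E" "x \<in> Arr E" "Cod E f = Cod E x" for f x
  proof -
    let ?S = "slice E (Cod E f)"
    have "Cod E f \<in> Obj E" using cat that(1) by (rule categoryD(4))
    then have "cartesian_closed ?S"
      using assms(1) by (simp add: locally_cartesian_closed_def)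
    moreover have "f \<in> Obj ?S" "x \<in> Obj ?S" using that by (simp_all add: slice_def)
    ultimately obtain P p1 p2 where "is_product ?S f x P p1 p2"
      unfolding cartesian_closed_def by meson
    then show ?thesis
      using slice_product_is_pullback[OF cat that(1,2) refl] that(3) by metis
  qed
  have prod: "\<exists>P p1 p2. is_product E A B P p1 p2" if AB: "A \<in> Obj E" "B \<in> Obj E" for A B
  proof -
    obtain U where U: "is_terminal E U" using assms(2) by (auto simp: has_terminal_def)
    obtain a b where ab: "a \<in> hom E A U" "b \<in> hom E B U"
      using U AB unfolding is_terminal_def by meson
    obtain P p1 p2 where "is_pullback E a b P p1 p2"
      using pb[of a b] ab by (auto simp: hom_def)
    then show ?thesis using pullback_over_terminal_is_product[OF cat U ab] by blast
  qed
  show ?thesis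
    by unfold_locales (fact cat, erule (2) pb, erule (1) prod)
qed

theorem proposition3p16:
  fixes E :: "('o, 'a) cat" and T :: 'o and \<mu> \<eta> :: 'a
  assumes "locally_cartesian_closed E" and "has_terminal E"
    and "monoid_object E T \<mu> \<eta>"
  shows "\<exists>D. is_functor D \<and> Src D = Poly E \<and> Tgt D = CAT \<and>
    (\<forall>p \<in> Obj (Poly E). OMap D p = Dyn E T \<mu> \<eta> p) \<and>
    (\<forall>p q \<phi>. \<phi> \<in> hom (Poly E) p q \<longrightarrow>
       (\<forall>X out upd. (X, out, upd) \<in> Obj (Dyn E T \<mu> \<eta> p) \<longrightarrow>
          OMap (AMap D \<phi>) (X, out, upd) =
            (X, Fwd \<phi> \<cdot>\<^bsub>E\<^esub> out, upd \<cdot>\<^bsub>E\<^esub> reindex E out (Fwd \<phi>) q p (Bwd \<phi>))) \<and>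
       (\<forall>\<theta> f \<psi>. (\<theta>, f, \<psi>) \<in> Arr (Dyn E T \<mu> \<eta> p) \<longrightarrow>
          AMap (AMap D \<phi>) (\<theta>, f, \<psi>) = (OMap (AMap D \<phi>) \<theta>, f, OMap (AMap D \<phi>) \<psi>)))"
proof -
  interpret finite_limit_category E
    using assms(1,2) by (rule finite_limit_category_of_lcc)
  interpret timed_category E T \<mu> \<eta>
    using assms(3) by unfold_locales (simp add: monoid_object_def)
  show ?thesis
  proof (intro exI[of _ dyn_indexed] conjI ballI allI impI)
    show "is_functor dyn_indexed" by (rule is_functor_dyn_indexed)
  qed (auto simp: dyn_indexed_def dyn_functor_def Poly_def hom_def Dyn_def change_interface_def)
qed

end
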